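(* Let $(\tau_t)$ be a quantum dynamical semigroup on a von Neumann algebra $\mathcal{A}_0$ acting on a separable Hilbert space $\mathcal{H}_0$, and let $\phi_0$ be a normal invariant state for $(\tau_t)$ with support projection $p$. Suppose that $\mathrm{s.lim}_{t\to\infty}\tau_t(p)=1$. Then the following statements are equivalent: (a) $\|\phi\tau_t-\phi_0\|\to 0$ as $t\to\infty$ for every normal state $\phi$ on $\mathcal{A}_0$; (b) $\|\phi\tau^p_t-\phi_0\|\to 0$ as $t\to\infty$ for every normal state $\phi$ on $\mathcal{A}^p_0$.
   Context: A quantum dynamical semigroup $(\tau_t)$ on a von Neumann algebra $\mathcal{A}_0$ acting on a separable Hilbert space $\mathcal{H}_0$ is a one-parameter semigroup of identity-preserving (unital), normal, completely positive maps $\tau_t:\mathcal{A}_0\to\mathcal{A}_0$, where $t$ ranges either over the nonnegative reals or over the nonnegative integers, such that $t\mapsto\tau_t(x)$ is weak$^*$ continuous for each $x\in\mathcal{A}_0$. A normal state $\phi_0$ is invariant if $\phi_0(\tau_t(x))=\phi_0(x)$ for all $x\in\mathcal{A}_0$ and $t\ge 0$. The support projection $p$ of a normal invariant state is sub-harmonic, i.e. $\tau_t(p)\ge p$ for all $t\ge 0$. The reduced semigroup $(\tau^p_t)$ on the von Neumann algebra $\mathcal{A}^p_0=p\mathcal{A}_0p$ (acting on $p\mathcal{H}_0$) is defined by $\tau^p_t(x)=p\tau_t(x)p$ for $x\in\mathcal{A}^p_0$, $t\ge 0$. In (b), $\phi_0$ denotes the restriction of $\phi_0$ to $\mathcal{A}^p_0$.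 The norms are the functional norms on $\mathcal{A}_0$ in (a) and on $\mathcal{A}^p_0$ in (b), and $\phi\tau_t$ denotes $\phi\circ\tau_t$. *)

theory Defs
  imports "HOL-Analysis.Analysis"
begin

text \<open>Complex Hilbert spaces; the inner product is conjugate-linear in the first argument.
  Positive definiteness follows from \<open>norm_eq_sqrt_cinner\<close> and the norm axioms,
  completeness is inherited from \<^class>\<open>banach\<close>.\<close>

class complex_hilbert_space = banach +
  fixes scaleC :: "complex \<Rightarrow> 'a \<Rightarrow> 'a" (infixr "*\<^sub>C" 75)
    and cinner :: "'a \<Rightarrow> 'a \<Rightarrow> complex"
  assumes scaleR_scaleC: "r *\<^sub>R x = complex_of_real r *\<^sub>C x"
    and scaleC_add_right: "a *\<^sub>C (x + y) = a *\<^sub>C x + a *\<^sub>C y"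
    and scaleC_add_left: "(a + b) *\<^sub>C x = a *\<^sub>C x + b *\<^sub>C x"
    and scaleC_scaleC: "a *\<^sub>C b *\<^sub>C x = (a * b) *\<^sub>C x"
    and cinner_commute: "cinner x y = cnj (cinner y x)"
    and cinner_add_right: "cinner x (y + z) = cinner x y + cinner x z"
    and cinner_scaleC_right: "cinner x (a *\<^sub>C y) = a * cinner x y"
    and norm_eq_sqrt_cinner: "norm x = sqrt (Re (cinner x x))"
begin

lemma cinner_add_left: "cinner (x + y) z = cinner x z + cinner y z"
  by (metis cinner_add_right cinner_commute complex_cnj_add)

lemma cinner_scaleC_left: "cinner (a *\<^sub>C x) y = cnj a * cinner x y"
  by (metis cinner_scaleC_right cinner_commute complex_cnj_mult)

lemma norm_scaleC: "norm (a *\<^sub>C x) = cmod a * norm x"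
proof -
  have "cinner (a *\<^sub>C x) (a *\<^sub>C x) = of_real ((cmod a)\<^sup>2) * cinner x x"
    by (simp add: cinner_scaleC_left cinner_scaleC_right complex_norm_square
        del: of_real_power)
  then have "Re (cinner (a *\<^sub>C x) (a *\<^sub>C x)) = (cmod a)\<^sup>2 * Re (cinner x x)"
    by simp
  then show ?thesis
    by (simp add: norm_eq_sqrt_cinner real_sqrt_mult)
qed

end

type_synonym 'h op = "'h \<Rightarrow>\<^sub>L 'h"

text \<open>The type \<open>'h op\<close> consists of the real-linear bounded operators; B(H) is the subset of the
  complex-linear ones. The norm of \<open>'h op\<close> is the usual operator norm.\<close>

definition BH :: "'h::complex_hilbert_space op set" where
  "BH = {x. \<forall>c v. blinfun_apply x (c *\<^sub>C v) = c *\<^sub>C blinfun_apply x v}"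

lift_definition scaleC_op :: "complex \<Rightarrow> 'h::complex_hilbert_space op \<Rightarrow> 'h op"
  is "\<lambda>c x v. c *\<^sub>C x v"
proof -
  fix c :: complex and x :: "'h \<Rightarrow> 'h"
  assume "bounded_linear x"
  moreover have "bounded_linear (\<lambda>v::'h. c *\<^sub>C v)"
    by (rule bounded_linear_intro[where K = "cmod c"])
      (simp_all add: scaleC_add_right scaleR_scaleC scaleC_scaleC norm_scaleC mult.commute)
  ultimately show "bounded_linear (\<lambda>v. c *\<^sub>C x v)"
    by (rule bounded_linear_compose[rotated])
qed

definition is_adjoint :: "'h::complex_hilbert_space op \<Rightarrow> 'h op \<Rightarrow> bool" where
  "is_adjoint y x \<longleftrightarrow> (\<forall>v w. cinner (blinfun_apply y v) w = cinner v (blinfun_apply x w))"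

definition positive_op :: "'h::complex_hilbert_space op \<Rightarrow> bool" where
  "positive_op x \<longleftrightarrow> (\<forall>v. cinner v (blinfun_apply x v) \<in> \<real>\<^sub>\<ge>\<^sub>0)"

definition projection :: "'h::complex_hilbert_space op \<Rightarrow> bool" where
  "projection p \<longleftrightarrow> p \<in> BH \<and> p o\<^sub>L p = p \<and> is_adjoint p p"

definition commutant :: "'h::complex_hilbert_space op set \<Rightarrow> 'h op set" where
  "commutant M = {y \<in> BH. \<forall>x\<in>M. x o\<^sub>L y = y o\<^sub>L x}"

text \<open>The condition on the bicommutant implies that a von Neumann algebra is a unital
  subalgebra of B(H).\<close>

definition von_neumann_algebra :: "'h::complex_hilbert_space op set \<Rightarrow> bool" where
  "von_neumann_algebra A \<longleftrightarrow>
     A \<subseteq> BH \<and> (\<forall>x\<in>A. \<exists>y\<in>A. is_adjoint y x) \<and> commutant (commutant A) = A"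

text \<open>For a projection \<open>p\<close> in \<open>A\<close> the algebra \<open>pAp\<close> acting on \<open>pH\<close> is represented as a set
  of operators on H which vanish on the orthogonal complement of \<open>pH\<close>; its unit is \<open>p\<close>.
  The operator norm, positivity and the weak* topology defined below are the same whether
  computed with vectors of H or of \<open>pH\<close>, since \<open>\<langle>v, pxp w\<rangle> = \<langle>pv, x pw\<rangle>\<close>.\<close>

definition corner :: "'h::complex_hilbert_space op \<Rightarrow> 'h op set \<Rightarrow> 'h op set" where
  "corner p A = (\<lambda>x. p o\<^sub>L x o\<^sub>L p) ` A"

text \<open>The weak* (ultraweak) topology on \<open>M\<close> is the coarsest one making the functionals
  \<open>x \<mapsto> \<Sum>n. \<langle>\<xi>\<^sub>n, x \<eta>\<^sub>n\<rangle>\<close> with square summable \<open>\<xi>\<close>, \<open>\<eta>\<close> continuous;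
  these functionals constitute the predual.\<close>

definition square_summable :: "(nat \<Rightarrow> 'h::complex_hilbert_space) \<Rightarrow> bool" where
  "square_summable \<xi> \<longleftrightarrow> summable (\<lambda>n. (norm (\<xi> n))\<^sup>2)"

definition predual_functional ::
  "(nat \<Rightarrow> 'h) \<Rightarrow> (nat \<Rightarrow> 'h) \<Rightarrow> 'h::complex_hilbert_space op \<Rightarrow> complex" where
  "predual_functional \<xi> \<eta> x = (\<Sum>n. cinner (\<xi> n) (blinfun_apply x (\<eta> n)))"

definition weak_star_topology :: "'h::complex_hilbert_space op set \<Rightarrow> 'h op topology" where
  "weak_star_topology M = topology_generated_by
     {{x \<in> M. predual_functional \<xi> \<eta> x \<in> U} | \<xi> \<eta> U.
        square_summable \<xi> \<and> square_summable \<eta> \<and> open U}"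

definition linear_functional_on ::
  "'h::complex_hilbert_space op set \<Rightarrow> ('h op \<Rightarrow> complex) \<Rightarrow> bool" where
  "linear_functional_on M \<phi> \<longleftrightarrow>
     (\<forall>x\<in>M. \<forall>y\<in>M. \<phi> (x + y) = \<phi> x + \<phi> y) \<and> (\<forall>c. \<forall>x\<in>M. \<phi> (scaleC_op c x) = c * \<phi> x)"

text \<open>A normal state on the von Neumann algebra \<open>M\<close> with unit \<open>e\<close>. Only the values of
  \<open>\<phi>\<close> on \<open>M\<close> matter; normality is continuity in the weak* topology.\<close>

definition normal_state ::
  "'h::complex_hilbert_space op set \<Rightarrow> 'h op \<Rightarrow> ('h op \<Rightarrow> complex) \<Rightarrow> bool" where
  "normal_state M e \<phi> \<longleftrightarrow>
     linear_functional_on M \<phi> \<and>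
     (\<forall>x\<in>M. positive_op x \<longrightarrow> \<phi> x \<in> \<real>\<^sub>\<ge>\<^sub>0) \<and>
     \<phi> e = 1 \<and>
     continuous_map (weak_star_topology M) euclidean \<phi>"

definition functional_norm ::
  "'h::complex_hilbert_space op set \<Rightarrow> ('h op \<Rightarrow> complex) \<Rightarrow> real" where
  "functional_norm M \<phi> = (SUP x \<in> {x \<in> M. norm x \<le> 1}. cmod (\<phi> x))"

definition support_projection ::
  "'h::complex_hilbert_space op set \<Rightarrow> ('h op \<Rightarrow> complex) \<Rightarrow> 'h op \<Rightarrow> bool" where
  "support_projection A \<phi> p \<longleftrightarrow>
     p \<in> A \<and> projection p \<and> \<phi> p = 1 \<and>
     (\<forall>q\<in>A. projection q \<and> \<phi> q = 1 \<longrightarrow> positive_op (q - p))"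

text \<open>Positivity of an \<open>n \<times> n\<close> matrix of operators, acting on the n-fold direct sum of H.\<close>

definition positive_matrix ::
  "nat \<Rightarrow> (nat \<Rightarrow> nat \<Rightarrow> 'h::complex_hilbert_space op) \<Rightarrow> bool" where
  "positive_matrix n a \<longleftrightarrow>
     (\<forall>v. (\<Sum>i<n. \<Sum>j<n. cinner (v i) (blinfun_apply (a i j) (v j))) \<in> \<real>\<^sub>\<ge>\<^sub>0)"

definition completely_positive ::
  "'h::complex_hilbert_space op set \<Rightarrow> ('h op \<Rightarrow> 'h op) \<Rightarrow> bool" where
  "completely_positive A T \<longleftrightarrow>
     (\<forall>x\<in>A. T x \<in> A) \<and>
     (\<forall>x\<in>A. \<forall>y\<in>A. T (x + y) = T x + T y) \<and>
     (\<forall>c. \<forall>x\<in>A. T (scaleC_op c x) = scaleC_op c (T x)) \<and>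
     (\<forall>n a. (\<forall>i<n. \<forall>j<n. a i j \<in> A) \<and> positive_matrix n a
        \<longrightarrow> positive_matrix n (\<lambda>i j. T (a i j)))"

text \<open>The set \<open>I\<close> of times is either the nonnegative reals or the nonnegative integers,
  the latter regarded as real numbers.\<close>

definition time_set :: "real set \<Rightarrow> bool" where
  "time_set I \<longleftrightarrow> I = {0..} \<or> I = \<nat>"

definition quantum_dynamical_semigroup ::
  "'h::complex_hilbert_space op set \<Rightarrow> real set \<Rightarrow> (real \<Rightarrow> 'h op \<Rightarrow> 'h op) \<Rightarrow> bool" where
  "quantum_dynamical_semigroup A I \<tau> \<longleftrightarrow>
     time_set I \<and>
     (\<forall>x\<in>A. \<tau> 0 x = x) \<and>
     (\<forall>s\<in>I. \<forall>t\<in>I. \<forall>x\<in>A. \<tau> (s + t) x = \<tau> s (\<tau> t x)) \<and>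
     (\<forall>t\<in>I. completely_positive A (\<tau> t) \<and> \<tau> t id_blinfun = id_blinfun \<and>
        continuous_map (weak_star_topology A) (weak_star_topology A) (\<tau> t)) \<and>
     (\<forall>x\<in>A. continuous_map (top_of_set I) (weak_star_topology A) (\<lambda>t. \<tau> t x))"

definition invariant_state ::
  "'h::complex_hilbert_space op set \<Rightarrow> real set \<Rightarrow> (real \<Rightarrow> 'h op \<Rightarrow> 'h op)
     \<Rightarrow> ('h op \<Rightarrow> complex) \<Rightarrow> bool" where
  "invariant_state A I \<tau> \<phi> \<longleftrightarrow> (\<forall>t\<in>I. \<forall>x\<in>A. \<phi> (\<tau> t x) = \<phi> x)"

definition reduced_semigroup ::
  "'h::complex_hilbert_space op \<Rightarrow> (real \<Rightarrow> 'h op \<Rightarrow> 'h op) \<Rightarrow> real \<Rightarrow> 'h op \<Rightarrow> 'h op" where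
  "reduced_semigroup p \<tau> t x = p o\<^sub>L \<tau> t x o\<^sub>L p"

definition at_infinity_in :: "real set \<Rightarrow> real filter" where
  "at_infinity_in I = inf at_top (principal I)"

end

theory Submission
  imports Defs
begin

text \<open>Write \<open>q = 1 - p\<close>. Everything rests on one elementary fact, \<open>nonneg_hermitian_form\<close>:
  a nonnegative form in one complex variable has Hermitian cross terms and satisfies the
  Cauchy--Schwarz inequality. It is applied to vectors, to states
  (\<open>normal_state_cauchy_schwarz\<close>) and to the two-by-two matrix with entries \<open>x\<^sup>* x\<close>, \<open>x\<^sup>*\<close>, \<open>x\<close>, \<open>1\<close>, where
  complete positivity turns it into \<open>\<tau>(x)\<^sup>* \<tau>(x) \<le> \<tau>(x\<^sup>* x)\<close> (\<open>kadison_schwarz\<close>).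

  Since \<open>\<phi>\<^sub>0(\<tau>\<^sub>t(q)) = \<phi>\<^sub>0(q) = 0\<close>, the invariant state does not see \<open>\<tau>\<^sub>t(q)\<close>, so the support of
  \<open>\<phi>\<^sub>0\<close> lies in the kernel of \<open>\<tau>\<^sub>t(q)\<close>: this is sub-harmonicity of \<open>p\<close>
  (\<open>support_projection_subharmonic\<close>). By the Schwarz inequality, \<open>\<tau>\<^sub>t(q) p = 0\<close> forces
  \<open>\<tau>\<^sub>t(x q) p = 0\<close> for all \<open>x\<close>, and hence \<open>p \<tau>\<^sub>t(x) p = p \<tau>\<^sub>t(p x p) p\<close>
  (\<open>subharmonic_compression\<close>): inside the corner the full evolution is the reduced one.

  A normal state \<open>\<phi>\<close> of the corner extends to the normal state \<open>x \<mapsto> \<phi>(p x p)\<close> of the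
  algebra, and the unit ball of the corner is contained in the unit ball of the algebra, so
  convergence for the full semigroup implies convergence for the reduced one.
  Conversely, let \<open>\<phi>\<close> be a normal state of the algebra. Because \<open>\<tau>\<^sub>s(p)\<close> tends to \<open>1\<close> and \<open>\<phi>\<close> is
  normal, at some time \<open>s\<close> the state \<open>\<psi> = \<phi> \<circ> \<tau>\<^sub>s\<close> has almost all of its mass in the corner. Up to
  an error of order \<open>sqrt (1 - \<psi>(p))\<close>, uniform on the unit ball and in the remaining time, the evolution of \<open>\<psi>\<close> is
  that of the normalized restriction \<open>\<psi>/\<psi>(p)\<close> under the reduced semigroup
  (\<open>state_deviation_le_corner\<close>), and this converges to \<open>\<phi>\<^sub>0\<close>.\<close>

section \<open>The inner product\<close>

text \<open>Reality of the form at \<open>z = 1\<close> and \<open>z = \<i>\<close> makes the cross terms conjugate to each other; along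
  the direction of \<open>- cnj b\<close> the form is a real quadratic polynomial without negative values,
  which bounds its discriminant.\<close>

lemma nonneg_hermitian_form:
  fixes a b b' c :: complex
  assumes form: "\<And>z. a + z * b + cnj z * b' + cnj z * z * c \<in> \<real>\<^sub>\<ge>\<^sub>0"
    and c: "c \<in> \<real>\<^sub>\<ge>\<^sub>0"
  shows "b' = cnj b" and "(cmod b)\<^sup>2 \<le> Re a * Re c"
proof -
  have a: "a \<in> \<real>\<^sub>\<ge>\<^sub>0"
    using form[of 0] by simp
  show b': "b' = cnj b"
    using form[of 1] form[of \<i>] a c
    by (auto simp: complex_nonneg_Reals_iff complex_eq_iff)
  have quad: "0 \<le> Re a - 2 * t * (cmod b)\<^sup>2 + t\<^sup>2 * (cmod b)\<^sup>2 * Re c" for t :: real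
  proof -
    have "Re (a + (- of_real t * cnj b) * b + cnj (- of_real t * cnj b) * b'
        + cnj (- of_real t * cnj b) * (- of_real t * cnj b) * c)
      = Re a - 2 * t * (cmod b)\<^sup>2 + t\<^sup>2 * (cmod b)\<^sup>2 * Re c"
      unfolding cmod_power2
      using c by (simp add: b' complex_nonneg_Reals_iff power2_eq_square algebra_simps)
    with form[of "- of_real t * cnj b"] show ?thesis
      by (simp add: complex_nonneg_Reals_iff)
  qed
  show "(cmod b)\<^sup>2 \<le> Re a * Re c"
  proof (cases "Re c = 0")
    case True
    show ?thesis
    proof (rule ccontr)
      assume "\<not> ?thesis"
      then have pos: "(cmod b)\<^sup>2 > 0"
        using True by simp
      \<comment> \<open>With vanishing quadratic term the polynomial is affine and equals \<open>-1\<close> at this point.\<close>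
      then show False
        using quad[of "(Re a + 1) / (2 * (cmod b)\<^sup>2)"] True by (simp add: field_simps)
    qed
  next
    case False
    then have "Re c > 0"
      using c by (simp add: complex_nonneg_Reals_iff)
    \<comment> \<open>The minimum of the quadratic polynomial.\<close>
    then show ?thesis
      using quad[of "1 / Re c"] by (simp add: power2_eq_square field_simps)
  qed
qed

lemma cinner_zero_right [simp]: "cinner x 0 = 0"
  for x :: "'h::complex_hilbert_space"
  using cinner_add_right[of x 0 0] by simp

lemma cinner_zero_left [simp]: "cinner 0 x = 0"
  for x :: "'h::complex_hilbert_space"
  using cinner_add_left[of 0 0 x] by simp

lemma cinner_diff_right: "cinner x (y - z) = cinner x y - cinner x z"
  for x :: "'h::complex_hilbert_space"
  using cinner_add_right[of x "y - z" z] by simp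

lemma cinner_diff_left: "cinner (x - y) z = cinner x z - cinner y z"
  for x :: "'h::complex_hilbert_space"
  using cinner_add_left[of "x - y" y z] by simp

lemma scaleC_diff_right: "c *\<^sub>C (v - w) = c *\<^sub>C v - c *\<^sub>C w"
  for v :: "'h::complex_hilbert_space"
  using scaleC_add_right[of c "v - w" w] by simp

lemma cinner_self: "cinner x x = of_real ((norm x)\<^sup>2)"
  for x :: "'h::complex_hilbert_space"
proof -
  have "0 \<le> sqrt (Re (cinner x x))"
    unfolding norm_eq_sqrt_cinner[symmetric] by simp
  then have "Re (cinner x x) \<ge> 0"
    by simp
  moreover have "Im (cinner x x) = 0"
    using cinner_commute[of x x] by (simp add: complex_eq_iff)
  ultimately show ?thesis
    by (simp add: complex_eq_iff norm_eq_sqrt_cinner)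
qed

lemma cinner_cauchy_schwarz: "cmod (cinner v w) \<le> norm v * norm w"
  for v :: "'h::complex_hilbert_space"
proof -
  have "cinner v v + z * cinner v w + cnj z * cinner w v + cnj z * z * cinner w w \<in> \<real>\<^sub>\<ge>\<^sub>0" for z
  proof -
    have "cinner v v + z * cinner v w + cnj z * cinner w v + cnj z * z * cinner w w
        = cinner (v + z *\<^sub>C w) (v + z *\<^sub>C w)"
      by (simp add: cinner_add_left cinner_add_right cinner_scaleC_left cinner_scaleC_right
          algebra_simps)
    then show ?thesis
      by (simp add: cinner_self complex_nonneg_Reals_iff del: of_real_power)
  qed
  moreover have "cinner w w \<in> \<real>\<^sub>\<ge>\<^sub>0"
    by (simp add: cinner_self complex_nonneg_Reals_iff del: of_real_power)
  ultimately have "(cmod (cinner v w))\<^sup>2 \<le> Re (cinner v v) * Re (cinner w w)"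
    by (rule nonneg_hermitian_form(2))
  also have "\<dots> = (norm v * norm w)\<^sup>2"
    by (simp add: cinner_self power_mult_distrib del: of_real_power)
  finally show ?thesis
    by (rule power2_le_imp_le) simp
qed

lemma norm_diff_square:
  "(norm (v - w))\<^sup>2 = (norm v)\<^sup>2 - 2 * Re (cinner v w) + (norm w)\<^sup>2"
  for v :: "'h::complex_hilbert_space"
proof -
  have "Re (cinner (v - w) (v - w))
      = Re (cinner v v) - Re (cinner v w) - Re (cinner w v) + Re (cinner w w)"
    by (simp only: cinner_diff_left cinner_diff_right) simp
  moreover have "Re (cinner w v) = Re (cinner v w)"
    by (subst cinner_commute) simp
  ultimately show ?thesis
    by (simp add: cinner_self del: of_real_power)
qed

lemma tendsto_cinner_right:
  fixes v :: "'h::complex_hilbert_space"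
  assumes "(f \<longlongrightarrow> w) F"
  shows "((\<lambda>t. cinner v (f t)) \<longlongrightarrow> cinner v w) F"
proof (rule LIM_zero_cancel, rule Lim_null_comparison)
  show "\<forall>\<^sub>F t in F. norm (cinner v (f t) - cinner v w) \<le> norm v * norm (f t - w)"
    unfolding cinner_diff_right[symmetric] by (simp add: cinner_cauchy_schwarz)
  show "((\<lambda>t. norm v * norm (f t - w)) \<longlongrightarrow> 0) F"
    by (intro tendsto_mult_right_zero tendsto_norm_zero LIM_zero assms)
qed

lemma tendsto_cinner_left:
  fixes v :: "'h::complex_hilbert_space"
  assumes "(f \<longlongrightarrow> w) F"
  shows "((\<lambda>t. cinner (f t) v) \<longlongrightarrow> cinner w v) F"
  using tendsto_cnj[OF tendsto_cinner_right[OF assms, of v]]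
  unfolding cinner_commute[symmetric, where y = v] .

text \<open>Multiplication by a scalar is the action of a bounded operator, hence continuous.\<close>

lemma tendsto_scaleC:
  fixes w :: "'h::complex_hilbert_space"
  assumes "(f \<longlongrightarrow> w) F"
  shows "((\<lambda>t. c *\<^sub>C f t) \<longlongrightarrow> c *\<^sub>C w) F"
proof -
  have "bounded_linear (\<lambda>v. blinfun_apply (scaleC_op c id_blinfun) v :: 'h)"
    by (rule blinfun.bounded_linear_right)
  from bounded_linear.tendsto[OF this assms] show ?thesis
    by (simp add: scaleC_op.rep_eq)
qed

section \<open>Adjoints and positivity of bounded operators\<close>

lemma is_adjoint_sym:
  assumes "is_adjoint y x"
  shows "is_adjoint x y"
  unfolding is_adjoint_def
proof (intro allI)
  fix v w
  have "cinner (x v) w = cnj (cinner w (x v))"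
    by (rule cinner_commute)
  also have "\<dots> = cnj (cinner (y w) v)"
    using assms by (simp add: is_adjoint_def)
  also have "\<dots> = cinner v (y w)"
    by (rule cinner_commute[symmetric])
  finally show "cinner (x v) w = cinner v (y w)" .
qed

lemma is_adjoint_compose:
  "is_adjoint xs x \<Longrightarrow> is_adjoint ys y \<Longrightarrow> is_adjoint (ys o\<^sub>L xs) (x o\<^sub>L y)"
  by (simp add: is_adjoint_def)

lemma is_adjoint_add: "is_adjoint xs x \<Longrightarrow> is_adjoint ys y \<Longrightarrow> is_adjoint (xs + ys) (x + y)"
  by (simp add: is_adjoint_def blinfun.add_left cinner_add_left cinner_add_right)

lemma is_adjoint_diff: "is_adjoint xs x \<Longrightarrow> is_adjoint ys y \<Longrightarrow> is_adjoint (xs - ys) (x - y)"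
  by (simp add: is_adjoint_def blinfun.diff_left cinner_diff_left cinner_diff_right)

lemma is_adjoint_scaleC: "is_adjoint xs x \<Longrightarrow> is_adjoint (scaleC_op (cnj c) xs) (scaleC_op c x)"
  by (simp add: is_adjoint_def scaleC_op.rep_eq cinner_scaleC_left cinner_scaleC_right)

lemma is_adjoint_id: "is_adjoint id_blinfun id_blinfun"
  by (simp add: is_adjoint_def)

lemma cinner_adjoint_compose:
  assumes "is_adjoint xs x"
  shows "cinner v ((xs o\<^sub>L x) v) = of_real ((norm (x v))\<^sup>2)"
  using is_adjoint_sym[OF assms] unfolding cinner_self[symmetric] by (simp add: is_adjoint_def)

lemma positive_op_adjoint_compose: "is_adjoint xs x \<Longrightarrow> positive_op (xs o\<^sub>L x)"
  unfolding positive_op_def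
  by (simp only: cinner_adjoint_compose) (simp add: complex_nonneg_Reals_iff del: of_real_power)

text \<open>The bound comes from \<open>\<parallel>x\<^sup>* v\<parallel>\<^sup>2 = \<langle>v, x x\<^sup>* v\<rangle> \<le> \<parallel>v\<parallel> \<parallel>x\<parallel> \<parallel>x\<^sup>* v\<parallel>\<close>.\<close>

lemma norm_adjoint_le:
  assumes "is_adjoint xs x"
  shows "norm xs \<le> norm x"
proof (rule norm_blinfun_bound)
  fix v
  have "(norm (xs v))\<^sup>2 = Re (cinner v (x (xs v)))"
    using assms cinner_self[of "xs v"] by (simp add: is_adjoint_def del: of_real_power)
  also have "\<dots> \<le> norm v * norm (x (xs v))"
    using complex_Re_le_cmod cinner_cauchy_schwarz order_trans by blast
  also have "\<dots> \<le> norm v * (norm x * norm (xs v))"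
    by (simp add: mult_left_mono norm_blinfun)
  finally have "norm (xs v) * norm (xs v) \<le> (norm x * norm v) * norm (xs v)"
    by (simp add: power2_eq_square mult_ac)
  then show "norm (xs v) \<le> norm x * norm v"
    by (cases "norm (xs v) = 0") (simp_all add: mult_le_cancel_right)
qed simp

lemma positive_op_norm_bound:
  assumes "is_adjoint xs x"
  shows "positive_op (scaleC_op (of_real ((norm x)\<^sup>2)) id_blinfun - (xs o\<^sub>L x))"
proof -
  have "cinner v ((scaleC_op (of_real ((norm x)\<^sup>2)) id_blinfun - (xs o\<^sub>L x)) v)
      = of_real ((norm x * norm v)\<^sup>2 - (norm (x v))\<^sup>2)" for v
    using cinner_adjoint_compose[OF assms, of v]
    by (simp add: blinfun.diff_left scaleC_op.rep_eq cinner_diff_right cinner_scaleC_right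
        cinner_self power_mult_distrib)
  moreover have "(norm (x v))\<^sup>2 \<le> (norm x * norm v)\<^sup>2" for v
    by (simp add: norm_blinfun power_mono)
  ultimately show ?thesis
    by (simp add: positive_op_def complex_nonneg_Reals_iff)
qed

lemma positive_op_conjugate:
  assumes "positive_op a" and "is_adjoint xs x"
  shows "positive_op (xs o\<^sub>L a o\<^sub>L x)"
proof -
  have "cinner v (xs w) = cinner (x v) w" for v w
    using is_adjoint_sym[OF assms(2)] by (simp add: is_adjoint_def)
  then show ?thesis
    using assms(1) by (simp add: positive_op_def)
qed

lemma projection_apply_idem: "projection p \<Longrightarrow> p (p v) = p v"
  unfolding projection_def by (metis blinfun_apply_blinfun_compose)

lemma projection_compl:
  assumes "projection p"
  shows "projection (id_blinfun - p)"
  unfolding projection_def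
proof (intro conjI)
  show "id_blinfun - p \<in> BH"
    using assms by (simp add: projection_def BH_def blinfun.diff_left scaleC_diff_right)
  show "(id_blinfun - p) o\<^sub>L (id_blinfun - p) = id_blinfun - p"
    by (rule blinfun_eqI)
      (simp add: blinfun.diff_left blinfun.diff_right projection_apply_idem[OF assms])
  show "is_adjoint (id_blinfun - p) (id_blinfun - p)"
    using assms by (intro is_adjoint_diff is_adjoint_id) (simp add: projection_def)
qed

lemma projection_positive:
  assumes "projection p"
  shows "positive_op p"
  using assms positive_op_adjoint_compose[of p p] by (simp add: projection_def)

lemma projection_norm_le:
  assumes "projection p"
  shows "norm p \<le> 1"
proof (rule norm_blinfun_bound)
  fix v
  have "(norm (p v))\<^sup>2 = Re (cinner v (p (p v)))"
    using assms cinner_self[of "p v"]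
    by (simp add: is_adjoint_def projection_def del: of_real_power)
  also have "\<dots> \<le> norm v * norm (p v)"
    using complex_Re_le_cmod cinner_cauchy_schwarz order_trans projection_apply_idem[OF assms]
    by metis
  finally have "norm (p v) * norm (p v) \<le> norm v * norm (p v)"
    by (simp add: power2_eq_square)
  then show "norm (p v) \<le> 1 * norm v"
    by (cases "norm (p v) = 0") (simp_all add: mult_le_cancel_right)
qed simp

text \<open>From \<open>p \<le> e\<close>, a vector \<open>w\<close> in the range of \<open>p\<close> has \<open>\<parallel>w\<parallel> \<le> \<parallel>e w\<parallel>\<close>, while
  \<open>\<parallel>w - e w\<parallel>\<^sup>2 = \<parallel>w\<parallel>\<^sup>2 - \<parallel>e w\<parallel>\<^sup>2\<close>; so \<open>w\<close> also lies in the range of \<open>e\<close>.\<close>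

lemma projection_le_absorbs:
  assumes p: "projection p" and e: "projection e" and le: "positive_op (e - p)"
  shows "e (p v) = p v"
proof -
  have e_sq: "cinner (p v) (e (p v)) = of_real ((norm (e (p v)))\<^sup>2)"
    using e cinner_adjoint_compose[of e e "p v"] by (simp add: projection_def)
  have "cinner (p v) ((e - p) (p v)) \<in> \<real>\<^sub>\<ge>\<^sub>0"
    using le by (simp add: positive_op_def)
  then have ge: "(norm (p v))\<^sup>2 \<le> (norm (e (p v)))\<^sup>2"
    using e_sq by (simp add: blinfun.diff_left cinner_diff_right projection_apply_idem[OF p]
        cinner_self complex_nonneg_Reals_iff)
  have "(norm (p v - e (p v)))\<^sup>2 = (norm (p v))\<^sup>2 - (norm (e (p v)))\<^sup>2"
    unfolding norm_diff_square e_sq by simp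
  then have "(norm (p v - e (p v)))\<^sup>2 \<le> 0"
    using ge by linarith
  then show ?thesis
    by simp
qed

section \<open>Algebraic closure properties of von Neumann algebras\<close>

lemma commutant_iff:
  fixes y :: "'h::complex_hilbert_space op"
  shows "y \<in> commutant M \<longleftrightarrow> y \<in> BH \<and> (\<forall>x\<in>M. \<forall>v. x (y v) = y (x v))"
  unfolding commutant_def
  by (auto intro!: blinfun_eqI) (metis blinfun_apply_blinfun_compose)

lemma commutant_subset_BH: "commutant M \<subseteq> BH"
  by (simp add: commutant_def)

text \<open>Both complex linearity and the commutation relations are identities between values of bounded
  operators at vectors, and so survive pointwise limits.\<close>

lemma commutant_strong_limit:
  fixes y :: "'h::complex_hilbert_space op" and x :: "nat \<Rightarrow> 'h op"
  assumes x: "\<And>n. x n \<in> commutant M" and lim: "\<And>v. (\<lambda>n. x n v) \<longlonglongrightarrow> y v"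
  shows "y \<in> commutant M"
  unfolding commutant_iff BH_def
proof (intro conjI CollectI ballI allI)
  fix c v
  have "x n (c *\<^sub>C v) = c *\<^sub>C x n v" for n
    using x[of n] by (simp add: commutant_iff BH_def)
  then have "(\<lambda>n. x n (c *\<^sub>C v)) \<longlonglongrightarrow> c *\<^sub>C y v"
    using tendsto_scaleC[OF lim[of v], of c] by simp
  then show "y (c *\<^sub>C v) = c *\<^sub>C y v"
    using lim LIMSEQ_unique by blast
next
  fix m v assume "m \<in> M"
  then have "(\<lambda>n. x n (m v)) \<longlonglongrightarrow> m (y v)"
    using blinfun.tendsto[OF tendsto_const lim[of v], of m] x by (simp add: commutant_iff)
  then show "m (y v) = y (m v)"
    using lim LIMSEQ_unique by blast
qed

context
  fixes A :: "'h::complex_hilbert_space op set"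
  assumes A: "von_neumann_algebra A"
begin

lemma von_neumann_BH: "x \<in> A \<Longrightarrow> x \<in> BH"
  using A by (auto simp: von_neumann_algebra_def)

lemma von_neumann_adjoint:
  assumes "x \<in> A"
  obtains xs where "xs \<in> A" and "is_adjoint xs x"
  using A assms by (auto simp: von_neumann_algebra_def)

text \<open>The bicommutant condition in pointwise form. Each algebraic closure property below is then an
  identity between vectors.\<close>

lemma von_neumann_iff:
  fixes x :: "'h op"
  shows "x \<in> A \<longleftrightarrow> x \<in> BH \<and> (\<forall>m\<in>commutant A. \<forall>v. m (x v) = x (m v))"
  using A commutant_iff[of x "commutant A"] by (simp add: von_neumann_algebra_def)

lemma von_neumann_id: "id_blinfun \<in> A"
  by (simp add: von_neumann_iff BH_def)

lemma von_neumann_compose: "x \<in> A \<Longrightarrow> y \<in> A \<Longrightarrow> x o\<^sub>L y \<in> A"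
  by (simp add: von_neumann_iff BH_def)

lemma von_neumann_add: "x \<in> A \<Longrightarrow> y \<in> A \<Longrightarrow> x + y \<in> A"
  by (simp add: von_neumann_iff BH_def blinfun.add_left blinfun.add_right scaleC_add_right)

lemma von_neumann_diff: "x \<in> A \<Longrightarrow> y \<in> A \<Longrightarrow> x - y \<in> A"
  by (simp add: von_neumann_iff BH_def blinfun.diff_left blinfun.diff_right scaleC_diff_right)

lemma von_neumann_scaleC: "x \<in> A \<Longrightarrow> scaleC_op c x \<in> A"
  using commutant_subset_BH[of A]
  by (auto simp: von_neumann_iff BH_def scaleC_op.rep_eq scaleC_scaleC mult.commute)

lemma von_neumann_strong_limit:
  fixes y :: "'h op" and x :: "nat \<Rightarrow> 'h op"
  assumes "\<And>n. x n \<in> A" and "\<And>v. (\<lambda>n. x n v) \<longlonglongrightarrow> y v"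
  shows "y \<in> A"
  using commutant_strong_limit[of x "commutant A" y] A assms
  by (simp add: von_neumann_algebra_def)

end

section \<open>The weak* topology\<close>

lemma topspace_weak_star [simp]: "topspace (weak_star_topology M) = M"
proof -
  have "x \<in> \<Union> {{x \<in> M. predual_functional \<xi> \<eta> x \<in> U} | \<xi> \<eta> U.
        square_summable \<xi> \<and> square_summable \<eta> \<and> open U}" if "x \<in> M" for x
  \<comment> \<open>The zero sequences give a subbasic set that is all of \<open>M\<close>.\<close>
  proof
    have "square_summable (\<lambda>_. 0 :: 'a)"
      by (simp add: square_summable_def)
    then show "{y \<in> M. predual_functional (\<lambda>_. 0) (\<lambda>_. 0) y \<in> UNIV} \<in>
        {{x \<in> M. predual_functional \<xi> \<eta> x \<in> U} | \<xi> \<eta> U.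
          square_summable \<xi> \<and> square_summable \<eta> \<and> open U}"
      using open_UNIV by blast
  qed (use that in simp)
  then show ?thesis
    unfolding weak_star_topology_def topology_generated_by_topspace by auto
qed

text \<open>It suffices that \<open>f\<close> pulls elements of the predual back to elements of the predual, since these
  generate the topology.\<close>

lemma continuous_map_weak_starI:
  assumes "\<And>x. x \<in> M \<Longrightarrow> f x \<in> N"
    and "\<And>\<xi> \<eta>. square_summable \<xi> \<Longrightarrow> square_summable \<eta> \<Longrightarrow>
      \<exists>\<xi>' \<eta>'. square_summable \<xi>' \<and> square_summable \<eta>' \<and>
        (\<forall>x\<in>M. predual_functional \<xi> \<eta> (f x) = predual_functional \<xi>' \<eta>' x)"
  shows "continuous_map (weak_star_topology M) (weak_star_topology N) f"
  unfolding weak_star_topology_def[of N]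
proof (rule continuous_on_generated_topo)
  let ?S = "\<lambda>M. {{x \<in> M. predual_functional \<xi> \<eta> x \<in> U} | \<xi> \<eta> U.
        square_summable \<xi> \<and> square_summable \<eta> \<and> open U}"
  fix V assume "V \<in> ?S N"
  then obtain \<xi> \<eta> U where V: "V = {x \<in> N. predual_functional \<xi> \<eta> x \<in> U}"
    and "square_summable \<xi>" "square_summable \<eta>" "open U"
    by blast
  then obtain \<xi>' \<eta>' where "square_summable \<xi>'" "square_summable \<eta>'"
    and eq: "\<forall>x\<in>M. predual_functional \<xi> \<eta> (f x) = predual_functional \<xi>' \<eta>' x"
    using assms(2) by meson
  then have "{x \<in> M. predual_functional \<xi>' \<eta>' x \<in> U} \<in> ?S M"
    using \<open>open U\<close> by blast
  moreover have "f -` V \<inter> topspace (weak_star_topology M)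
      = {x \<in> M. predual_functional \<xi>' \<eta>' x \<in> U}"
    using assms(1) eq by (auto simp: V)
  ultimately show "openin (weak_star_topology M) (f -` V \<inter> topspace (weak_star_topology M))"
    by (simp only: weak_star_topology_def[of M] topology_generated_by_Basis)
next
  show "f ` topspace (weak_star_topology M) \<subseteq> \<Union> {{x \<in> N. predual_functional \<xi> \<eta> x \<in> U} | \<xi> \<eta> U.
        square_summable \<xi> \<and> square_summable \<eta> \<and> open U}"
    using topspace_weak_star[of N] assms(1)
    unfolding weak_star_topology_def[of N] topology_generated_by_topspace by auto
qed

lemma square_summable_apply:
  fixes x :: "'h::complex_hilbert_space op"
  assumes "square_summable \<xi>"
  shows "square_summable (\<lambda>n. blinfun_apply x (\<xi> n))"
  unfolding square_summable_def
proof (rule summable_comparison_test')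
  show "summable (\<lambda>n. (norm x)\<^sup>2 * (norm (\<xi> n))\<^sup>2)"
    using assms by (simp add: square_summable_def summable_mult)
  show "norm ((norm (x (\<xi> n)))\<^sup>2) \<le> (norm x)\<^sup>2 * (norm (\<xi> n))\<^sup>2" if "n \<ge> 0" for n
    using power_mono[OF norm_blinfun, of x "\<xi> n" 2] by (simp add: power_mult_distrib)
qed

text \<open>The terms of the series converge one by one, and \<open>K (\<parallel>\<xi>\<^sub>k\<parallel>\<^sup>2 + \<parallel>\<eta>\<^sub>k\<parallel>\<^sup>2)\<close> is a summable majorant
  independent of \<open>t\<close>; hence limit and sum can be exchanged.\<close>

lemma predual_functional_tendsto:
  fixes y :: "'h::complex_hilbert_space op" and x :: "'t \<Rightarrow> 'h op"
  assumes \<xi>: "square_summable \<xi>" and \<eta>: "square_summable \<eta>"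
    and F: "F \<noteq> bot" and bound: "\<forall>\<^sub>F t in F. norm (x t) \<le> K"
    and lim: "\<And>v. ((\<lambda>t. x t v) \<longlongrightarrow> y v) F"
  shows "((\<lambda>t. predual_functional \<xi> \<eta> (x t)) \<longlongrightarrow> predual_functional \<xi> \<eta> y) F"
proof -
  have estimate: "norm (cinner (\<xi> k) (x t (\<eta> k))) \<le> K * ((norm (\<xi> k))\<^sup>2 + (norm (\<eta> k))\<^sup>2)"
    if "norm (x t) \<le> K" for k t
  proof -
    have K: "0 \<le> K"
      using that norm_ge_zero order_trans by blast
    have "norm (cinner (\<xi> k) (x t (\<eta> k))) \<le> norm (\<xi> k) * (K * norm (\<eta> k))"
      by (intro order_trans[OF cinner_cauchy_schwarz] mult_left_mono
          order_trans[OF norm_blinfun] mult_right_mono that) simp_all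
    also have "\<dots> = K * (norm (\<xi> k) * norm (\<eta> k))"
      by simp
    also have "\<dots> \<le> K * ((norm (\<xi> k))\<^sup>2 + (norm (\<eta> k))\<^sup>2)"
    proof (rule mult_left_mono[OF _ K])
      show "norm (\<xi> k) * norm (\<eta> k) \<le> (norm (\<xi> k))\<^sup>2 + (norm (\<eta> k))\<^sup>2"
        using sum_squares_bound[of "norm (\<xi> k)" "norm (\<eta> k)"]
          mult_nonneg_nonneg[OF norm_ge_zero[of "\<xi> k"] norm_ge_zero[of "\<eta> k"]] by linarith
    qed
    finally show ?thesis .
  qed
  have "\<forall>\<^sub>F (k, t) in sequentially \<times>\<^sub>F F. norm (x t) \<le> K"
    using bound by (simp add: eventually_prod2)
  then have "\<forall>\<^sub>F (k, t) in sequentially \<times>\<^sub>F F.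
      norm (cinner (\<xi> k) (x t (\<eta> k))) \<le> K * ((norm (\<xi> k))\<^sup>2 + (norm (\<eta> k))\<^sup>2)"
    by (rule eventually_mono) (use estimate in auto)
  moreover have "summable (\<lambda>k. K * ((norm (\<xi> k))\<^sup>2 + (norm (\<eta> k))\<^sup>2))"
    using \<xi> \<eta> unfolding square_summable_def by (intro summable_mult summable_add)
  moreover have "((\<lambda>t. cinner (\<xi> k) (x t (\<eta> k))) \<longlongrightarrow> cinner (\<xi> k) (y (\<eta> k))) F" for k
    by (intro tendsto_cinner_right lim)
  ultimately show ?thesis
    unfolding predual_functional_def
    using tannerys_theorem[where a = "\<lambda>k t. cinner (\<xi> k) (x t (\<eta> k))"
        and b = "\<lambda>k. cinner (\<xi> k) (y (\<eta> k))", OF _ _ _ F] by simp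
qed

text \<open>On bounded sets strong convergence implies weak* convergence; this is how normality of a state
  lets it pass to strong limits.\<close>

lemma weak_star_continuous_tendsto:
  fixes y :: "'h::complex_hilbert_space op" and x :: "'t \<Rightarrow> 'h op"
  assumes \<phi>: "continuous_map (weak_star_topology M) euclidean \<phi>"
    and F: "F \<noteq> bot" and x: "\<forall>\<^sub>F t in F. x t \<in> M" and y: "y \<in> M"
    and bound: "\<forall>\<^sub>F t in F. norm (x t) \<le> K"
    and lim: "\<And>v. ((\<lambda>t. x t v) \<longlongrightarrow> y v) F"
  shows "((\<lambda>t. \<phi> (x t)) \<longlongrightarrow> \<phi> y) F"
proof -
  let ?S = "{{x \<in> M. predual_functional \<xi> \<eta> x \<in> U} | \<xi> \<eta> U.
        square_summable \<xi> \<and> square_summable \<eta> \<and> open U}"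
  have "\<forall>\<^sub>F t in F. x t \<in> V" if "generate_topology_on ?S V" "y \<in> V" for V
    using that
  proof (induction rule: generate_topology_on.induct)
    case (UN K)
    then obtain k where "k \<in> K" "y \<in> k"
      by blast
    with UN.IH have "\<forall>\<^sub>F t in F. x t \<in> k"
      by blast
    then show ?case
      by (rule eventually_mono) (use \<open>k \<in> K\<close> in blast)
  next
    case (Basis V)
    then obtain \<xi> \<eta> U where V: "V = {x \<in> M. predual_functional \<xi> \<eta> x \<in> U}"
      and *: "square_summable \<xi>" "square_summable \<eta>" "open U"
      by blast
    have "\<forall>\<^sub>F t in F. predual_functional \<xi> \<eta> (x t) \<in> U"
      using predual_functional_tendsto[OF *(1,2) F bound lim] *(3) Basis.prems
      by (auto simp: V intro: topological_tendstoD)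
    with x show ?case
      by eventually_elim (simp add: V)
  qed (auto intro: eventually_conj)
  then have "limitin (weak_star_topology M) x y F"
    using y unfolding limitin_def topspace_weak_star
    by (simp add: weak_star_topology_def openin_topology_generated_by_iff)
  from continuous_map_limit[OF \<phi> this] show ?thesis
    by (simp add: o_def)
qed

section \<open>Normal states\<close>

lemma normal_state_add:
  "normal_state M e \<phi> \<Longrightarrow> x \<in> M \<Longrightarrow> y \<in> M \<Longrightarrow> \<phi> (x + y) = \<phi> x + \<phi> y"
  by (simp add: normal_state_def linear_functional_on_def)

lemma normal_state_scaleC:
  "normal_state M e \<phi> \<Longrightarrow> x \<in> M \<Longrightarrow> \<phi> (scaleC_op c x) = c * \<phi> x"
  by (simp add: normal_state_def linear_functional_on_def)

lemma normal_state_positive: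
  "normal_state M e \<phi> \<Longrightarrow> x \<in> M \<Longrightarrow> positive_op x \<Longrightarrow> \<phi> x \<in> \<real>\<^sub>\<ge>\<^sub>0"
  by (simp add: normal_state_def)

lemma normal_state_unit: "normal_state M e \<phi> \<Longrightarrow> \<phi> e = 1"
  by (simp add: normal_state_def)

lemma normal_state_continuous:
  "normal_state M e \<phi> \<Longrightarrow> continuous_map (weak_star_topology M) euclidean \<phi>"
  by (simp add: normal_state_def)

lemma normal_state_diff:
  assumes "normal_state M e \<phi>" and "x - y \<in> M" and "y \<in> M"
  shows "\<phi> (x - y) = \<phi> x - \<phi> y"
  using normal_state_add[OF assms] by simp

context
  fixes A :: "'h::complex_hilbert_space op set" and e \<phi>
  assumes A: "von_neumann_algebra A" and \<phi>: "normal_state A e \<phi>"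
begin

lemma normal_state_mono:
  assumes "x \<in> A" "y \<in> A" "positive_op (y - x)"
  shows "Re (\<phi> x) \<le> Re (\<phi> y)"
  using normal_state_positive[OF \<phi> von_neumann_diff[OF A assms(2,1)] assms(3)]
    normal_state_diff[OF \<phi> von_neumann_diff[OF A assms(2,1)] assms(1)]
  by (simp add: complex_nonneg_Reals_iff)

text \<open>The positive operators \<open>(x + z y)\<^sup>* (x + z y)\<close> give the form in \<open>z\<close> to which
  \<open>nonneg_hermitian_form\<close> applies.\<close>

lemma normal_state_cauchy_schwarz:
  assumes mem: "x \<in> A" "xs \<in> A" "y \<in> A" "ys \<in> A"
    and adj: "is_adjoint xs x" "is_adjoint ys y"
  shows "\<phi> (ys o\<^sub>L x) = cnj (\<phi> (xs o\<^sub>L y))"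
    and "(cmod (\<phi> (xs o\<^sub>L y)))\<^sup>2 \<le> Re (\<phi> (xs o\<^sub>L x)) * Re (\<phi> (ys o\<^sub>L y))"
proof -
  note closed = von_neumann_compose[OF A] von_neumann_add[OF A] von_neumann_scaleC[OF A] mem
  have "\<phi> (xs o\<^sub>L x) + z * \<phi> (xs o\<^sub>L y) + cnj z * \<phi> (ys o\<^sub>L x) + cnj z * z * \<phi> (ys o\<^sub>L y)
      \<in> \<real>\<^sub>\<ge>\<^sub>0" for z
  proof -
    have "(xs + scaleC_op (cnj z) ys) o\<^sub>L (x + scaleC_op z y)
        = (xs o\<^sub>L x) + scaleC_op z (xs o\<^sub>L y) + scaleC_op (cnj z) (ys o\<^sub>L x)
          + scaleC_op (cnj z * z) (ys o\<^sub>L y)"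
      using mem[THEN von_neumann_BH[OF A]]
      by (intro blinfun_eqI)
        (simp add: BH_def blinfun.add_left blinfun.add_right scaleC_op.rep_eq scaleC_add_right
          scaleC_scaleC)
    moreover have "\<phi> ((xs + scaleC_op (cnj z) ys) o\<^sub>L (x + scaleC_op z y)) \<in> \<real>\<^sub>\<ge>\<^sub>0"
      by (intro normal_state_positive[OF \<phi>] positive_op_adjoint_compose is_adjoint_add
          is_adjoint_scaleC adj closed)
    ultimately show ?thesis
      by (simp add: closed normal_state_add[OF \<phi>] normal_state_scaleC[OF \<phi>])
  qed
  moreover have "\<phi> (ys o\<^sub>L y) \<in> \<real>\<^sub>\<ge>\<^sub>0"
    by (intro normal_state_positive[OF \<phi>] positive_op_adjoint_compose adj closed)
  ultimately show "\<phi> (ys o\<^sub>L x) = cnj (\<phi> (xs o\<^sub>L y))"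
    and "(cmod (\<phi> (xs o\<^sub>L y)))\<^sup>2 \<le> Re (\<phi> (xs o\<^sub>L x)) * Re (\<phi> (ys o\<^sub>L y))"
    by (rule nonneg_hermitian_form)+
qed

end

context
  fixes A :: "'h::complex_hilbert_space op set" and \<phi>
  assumes A: "von_neumann_algebra A" and \<phi>: "normal_state A id_blinfun \<phi>"
begin

lemma normal_state_adjoint_square_le:
  assumes "x \<in> A" "xs \<in> A" "is_adjoint xs x"
  shows "Re (\<phi> (xs o\<^sub>L x)) \<le> (norm x)\<^sup>2"
proof -
  have "Re (\<phi> (xs o\<^sub>L x)) \<le> Re (\<phi> (scaleC_op (of_real ((norm x)\<^sup>2)) id_blinfun))"
    by (intro normal_state_mono[OF A \<phi>] von_neumann_compose[OF A] von_neumann_scaleC[OF A]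
        von_neumann_id[OF A] positive_op_norm_bound assms)
  also have "\<dots> = (norm x)\<^sup>2"
    by (simp add: normal_state_scaleC[OF \<phi>] von_neumann_id[OF A] normal_state_unit[OF \<phi>]
        del: of_real_power)
  finally show ?thesis .
qed

text \<open>Cauchy--Schwarz for the pair \<open>q, x\<close> and for the pair \<open>x\<^sup>*, q\<close>, where \<open>q\<^sup>* q = q\<close>: if \<open>\<phi>(q)\<close>
  is small, then \<open>\<phi>\<close> nearly vanishes on all operators with a factor \<open>q\<close>.\<close>

lemma normal_state_projection_bound:
  assumes q: "q \<in> A" "projection q" and x: "x \<in> A"
  shows "cmod (\<phi> (q o\<^sub>L x)) \<le> sqrt (Re (\<phi> q)) * norm x"
    and "cmod (\<phi> (x o\<^sub>L q)) \<le> sqrt (Re (\<phi> q)) * norm x"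
proof -
  obtain xs where xs: "xs \<in> A" "is_adjoint xs x"
    using von_neumann_adjoint[OF A x] .
  have qq: "q o\<^sub>L q = q" "is_adjoint q q"
    using q(2) by (simp_all add: projection_def)
  have pos: "0 \<le> Re (\<phi> q)"
    using normal_state_positive[OF \<phi> q(1) projection_positive[OF q(2)]]
    by (simp add: complex_nonneg_Reals_iff)
  have root: "r \<le> sqrt (Re (\<phi> q)) * norm x" if "r\<^sup>2 \<le> Re (\<phi> q) * (norm x)\<^sup>2" for r
    using real_le_rsqrt[OF that] by (simp add: real_sqrt_mult)
  have "(cmod (\<phi> (q o\<^sub>L x)))\<^sup>2 \<le> Re (\<phi> q) * Re (\<phi> (xs o\<^sub>L x))"
    using normal_state_cauchy_schwarz(2)[OF A \<phi> q(1) q(1) x xs(1) qq(2) xs(2)] by (simp add: qq)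
  also have "\<dots> \<le> Re (\<phi> q) * (norm x)\<^sup>2"
    by (intro mult_left_mono normal_state_adjoint_square_le x xs pos)
  finally show "cmod (\<phi> (q o\<^sub>L x)) \<le> sqrt (Re (\<phi> q)) * norm x"
    by (rule root)
  have "(cmod (\<phi> (x o\<^sub>L q)))\<^sup>2 \<le> Re (\<phi> (x o\<^sub>L xs)) * Re (\<phi> q)"
    using normal_state_cauchy_schwarz(2)[OF A \<phi> xs(1) x q(1) q(1) is_adjoint_sym[OF xs(2)] qq(2)]
    by (simp add: qq)
  also have "\<dots> \<le> (norm xs)\<^sup>2 * Re (\<phi> q)"
    by (intro mult_right_mono normal_state_adjoint_square_le x xs pos is_adjoint_sym[OF xs(2)])
  also have "\<dots> \<le> (norm x)\<^sup>2 * Re (\<phi> q)"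
    by (intro mult_right_mono power_mono norm_adjoint_le xs pos) simp
  finally show "cmod (\<phi> (x o\<^sub>L q)) \<le> sqrt (Re (\<phi> q)) * norm x"
    by (intro root) (simp add: mult.commute)
qed

lemma normal_state_norm_le:
  assumes "x \<in> A"
  shows "cmod (\<phi> x) \<le> norm x"
proof -
  have "projection id_blinfun" "id_blinfun o\<^sub>L x = x"
    by (auto simp: projection_def BH_def is_adjoint_id intro: blinfun_eqI)
  then show ?thesis
    using normal_state_projection_bound(1)[OF von_neumann_id[OF A] _ assms]
    by (simp add: normal_state_unit[OF \<phi>])
qed

text \<open>With \<open>q = 1 - p\<close> the difference is \<open>\<phi>(q x) + \<phi>(p x q)\<close>, and both terms contain a factor \<open>q\<close>.
  In particular a state with \<open>\<phi>(p) = 1\<close> is determined by its values on the corner.\<close>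

lemma normal_state_compression:
  assumes p: "p \<in> A" "projection p" and x: "x \<in> A"
  shows "cmod (\<phi> x - \<phi> (p o\<^sub>L x o\<^sub>L p)) \<le> 2 * sqrt (1 - Re (\<phi> p)) * norm x"
proof -
  define q where "q = id_blinfun - p"
  have q: "q \<in> A" "projection q"
    using p by (auto simp: q_def von_neumann_diff[OF A] von_neumann_id[OF A] projection_compl)
  have \<phi>q: "Re (\<phi> q) = 1 - Re (\<phi> p)"
    using normal_state_diff[OF \<phi> _ p(1), of id_blinfun] q(1)
    by (simp add: q_def normal_state_unit[OF \<phi>])
  note closed = von_neumann_compose[OF A] von_neumann_add[OF A] q(1) p(1) x
  have "x = (q o\<^sub>L x) + (p o\<^sub>L x o\<^sub>L q) + (p o\<^sub>L x o\<^sub>L p)"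
    by (rule blinfun_eqI)
      (simp add: q_def blinfun.add_left blinfun.diff_left blinfun.diff_right)
  then have "\<phi> x = \<phi> (q o\<^sub>L x) + \<phi> (p o\<^sub>L x o\<^sub>L q) + \<phi> (p o\<^sub>L x o\<^sub>L p)"
    by (metis closed normal_state_add[OF \<phi>])
  then have "cmod (\<phi> x - \<phi> (p o\<^sub>L x o\<^sub>L p)) \<le> cmod (\<phi> (q o\<^sub>L x)) + cmod (\<phi> (p o\<^sub>L x o\<^sub>L q))"
    by (simp add: norm_triangle_ineq)
  also have "\<dots> \<le> sqrt (Re (\<phi> q)) * norm x + sqrt (Re (\<phi> q)) * norm x"
  proof (rule add_mono)
    show "cmod (\<phi> (q o\<^sub>L x)) \<le> sqrt (Re (\<phi> q)) * norm x"
      by (rule normal_state_projection_bound(1)[OF q x])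
    have q_pos: "\<phi> q \<in> \<real>\<^sub>\<ge>\<^sub>0"
      by (intro normal_state_positive[OF \<phi>] projection_positive q)
    have "cmod (\<phi> (p o\<^sub>L x o\<^sub>L q)) \<le> sqrt (Re (\<phi> q)) * norm (p o\<^sub>L x)"
      by (rule normal_state_projection_bound(2)[OF q]) (intro closed)
    also have "\<dots> \<le> sqrt (Re (\<phi> q)) * norm x"
    proof (rule mult_left_mono)
      have "norm (p o\<^sub>L x) \<le> norm p * norm x"
        by (rule norm_blinfun_compose)
      also have "\<dots> \<le> 1 * norm x"
        by (intro mult_right_mono projection_norm_le p norm_ge_zero)
      finally show "norm (p o\<^sub>L x) \<le> norm x"
        by simp
      show "0 \<le> sqrt (Re (\<phi> q))"
        using q_pos by (simp add: complex_nonneg_Reals_iff)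
    qed
    finally show "cmod (\<phi> (p o\<^sub>L x o\<^sub>L q)) \<le> sqrt (Re (\<phi> q)) * norm x" .
  qed
  finally show ?thesis
    by (simp add: \<phi>q mult_ac)
qed

end

section \<open>Schwarz inequality for unital completely positive maps\<close>

lemma cp_mem: "completely_positive A T \<Longrightarrow> x \<in> A \<Longrightarrow> T x \<in> A"
  by (simp add: completely_positive_def)

lemma cp_add:
  "completely_positive A T \<Longrightarrow> x \<in> A \<Longrightarrow> y \<in> A \<Longrightarrow> T (x + y) = T x + T y"
  by (simp add: completely_positive_def)

lemma cp_scaleC:
  "completely_positive A T \<Longrightarrow> x \<in> A \<Longrightarrow> T (scaleC_op c x) = scaleC_op c (T x)"
  by (simp add: completely_positive_def)

lemma cp_matrix:
  assumes "completely_positive A T"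
    and "\<And>i j. i < n \<Longrightarrow> j < n \<Longrightarrow> a i j \<in> A" and "positive_matrix n a"
  shows "positive_matrix n (\<lambda>i j. T (a i j))"
  using assms unfolding completely_positive_def by blast

text \<open>The case of one-by-one matrices.\<close>

lemma cp_positive:
  assumes "completely_positive A T" "x \<in> A" "positive_op x"
  shows "positive_op (T x)"
proof -
  have "positive_matrix 1 (\<lambda>_ _. T x)"
    using assms by (intro cp_matrix[OF assms(1)]) (simp_all add: positive_matrix_def positive_op_def)
  then show ?thesis
    unfolding positive_op_def positive_matrix_def by (auto dest: spec[of _ "\<lambda>_. _"])
qed

context
  fixes A :: "'h::complex_hilbert_space op set" and T :: "'h op \<Rightarrow> 'h op"
  assumes A: "von_neumann_algebra A" and cp: "completely_positive A T"
begin

lemma cp_diff: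
  assumes "x \<in> A" "y \<in> A"
  shows "T (x - y) = T x - T y"
  using cp_add[OF cp von_neumann_diff[OF A assms] assms(2)] by (simp add: algebra_simps)

lemma cp_mono:
  assumes "x \<in> A" "y \<in> A" "positive_op (y - x)"
  shows "Re (cinner v (T x v)) \<le> Re (cinner v (T y v))"
  using cp_positive[OF cp von_neumann_diff[OF A assms(2,1)] assms(3)] cp_diff[OF assms(2,1)]
  by (simp add: positive_op_def blinfun.diff_left cinner_diff_right complex_nonneg_Reals_iff)

end

context
  fixes A :: "'h::complex_hilbert_space op set" and T :: "'h op \<Rightarrow> 'h op"
  assumes A: "von_neumann_algebra A"
    and cp: "completely_positive A T" and unital: "T id_blinfun = id_blinfun"
begin

text \<open>The matrix with rows \<open>(x\<^sup>* x, x\<^sup>*)\<close> and \<open>(x, 1)\<close> is positive because its form at \<open>(u, w)\<close> is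
  \<open>\<parallel>x u + w\<parallel>\<^sup>2\<close>. Two-positivity of \<open>T\<close> makes the form of the image matrix nonnegative at
  \<open>(u, z w)\<close> for every scalar \<open>z\<close>. Its cross terms being conjugate says that \<open>T\<close> preserves
  adjoints, and its Cauchy--Schwarz inequality at \<open>w = T x u\<close> is the Schwarz inequality for \<open>T\<close>.\<close>

lemma
  assumes mem: "x \<in> A" "xs \<in> A" and adj: "is_adjoint xs x"
  shows cp_adjoint: "is_adjoint (T xs) (T x)"
    and kadison_schwarz: "(norm (T x v))\<^sup>2 \<le> Re (cinner v (T (xs o\<^sub>L x) v))"
proof -
  define a where "a i j = (if i = (0::nat) then if j = (0::nat) then xs o\<^sub>L x else xs
      else if j = 0 then x else id_blinfun)" for i j
  have two: "{..<2} = {0, 1::nat}"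
    by auto
  have swap: "cinner u (xs w) = cinner (x u) w" for u w
    using is_adjoint_sym[OF adj] by (simp add: is_adjoint_def)
  have "(\<Sum>i<2. \<Sum>j<2. cinner (u i) (a i j (u j)))
      = cinner (x (u 0) + u 1) (x (u 0) + u 1)" for u
    by (simp add: two a_def swap cinner_add_left cinner_add_right)
  then have "positive_matrix 2 a"
    unfolding positive_matrix_def
    by (simp add: cinner_self complex_nonneg_Reals_iff del: of_real_power)
  then have "positive_matrix 2 (\<lambda>i j. T (a i j))"
    by (rule cp_matrix[OF cp, rotated])
      (simp add: a_def mem von_neumann_compose[OF A] von_neumann_id[OF A])
  then have T_form: "cinner u (T (xs o\<^sub>L x) u) + cinner u (T xs w) + cinner w (T x u)
      + cinner w w \<in> \<real>\<^sub>\<ge>\<^sub>0" for u w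
    unfolding positive_matrix_def
    by (auto simp: two a_def unital add_ac dest: spec[of _ "\<lambda>i. if i = 0 then u else w"])
  have BH: "T xs \<in> BH"
    using cp_mem[OF cp mem(2)] von_neumann_BH[OF A] by blast
  have form: "cinner u (T (xs o\<^sub>L x) u) + z * cinner u (T xs w) + cnj z * cinner w (T x u)
      + cnj z * z * cinner w w \<in> \<real>\<^sub>\<ge>\<^sub>0" for u w z
    using T_form[of u "z *\<^sub>C w"] BH
    by (simp add: BH_def cinner_scaleC_left cinner_scaleC_right mult_ac)
  have pos: "cinner w w \<in> \<real>\<^sub>\<ge>\<^sub>0" for w :: 'h
    by (simp add: cinner_self complex_nonneg_Reals_iff del: of_real_power)
  have herm: "cinner w (T x u) = cnj (cinner u (T xs w))" for u w
    by (rule nonneg_hermitian_form(1)[OF form pos])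
  then show "is_adjoint (T xs) (T x)"
    unfolding is_adjoint_def by (metis cinner_commute)
  have "(cmod (cinner v (T xs (T x v))))\<^sup>2
      \<le> Re (cinner v (T (xs o\<^sub>L x) v)) * Re (cinner (T x v) (T x v))"
    by (rule nonneg_hermitian_form(2)[OF form pos])
  moreover have "cmod (cinner v (T xs (T x v))) = cmod (cinner (T x v) (T x v))"
    using herm[of "T x v" v] by simp
  ultimately have le: "(norm (T x v))\<^sup>2 * (norm (T x v))\<^sup>2
      \<le> Re (cinner v (T (xs o\<^sub>L x) v)) * (norm (T x v))\<^sup>2"
    by (simp add: cinner_self power2_eq_square flip: of_real_mult)
  show "(norm (T x v))\<^sup>2 \<le> Re (cinner v (T (xs o\<^sub>L x) v))"
  proof (cases "T x v = 0")
    case True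
    then show ?thesis
      using form[of v 0 v] by (simp add: complex_nonneg_Reals_iff)
  next
    case False
    then show ?thesis
      by (intro mult_right_le_imp_le[OF le]) simp
  qed
qed

text \<open>The Schwarz inequality combined with \<open>x\<^sup>* x \<le> \<parallel>x\<parallel>\<^sup>2\<close> and unitality.\<close>

lemma cp_contraction:
  assumes "x \<in> A"
  shows "norm (T x) \<le> norm x"
proof (rule norm_blinfun_bound)
  fix v
  obtain xs where xs: "xs \<in> A" "is_adjoint xs x"
    using von_neumann_adjoint[OF A assms] .
  have "(norm (T x v))\<^sup>2 \<le> Re (cinner v (T (xs o\<^sub>L x) v))"
    by (rule kadison_schwarz[OF assms xs])
  also have "\<dots> \<le> Re (cinner v (T (scaleC_op (of_real ((norm x)\<^sup>2)) id_blinfun) v))"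
    by (intro cp_mono[OF A cp] von_neumann_compose[OF A] von_neumann_scaleC[OF A] von_neumann_id[OF A]
        positive_op_norm_bound assms xs)
  also have "\<dots> = (norm x * norm v)\<^sup>2"
    by (simp add: cp_scaleC[OF cp] von_neumann_id[OF A] unital scaleC_op.rep_eq cinner_scaleC_right
        cinner_self power_mult_distrib flip: of_real_power of_real_mult)
  finally show "norm (T x v) \<le> norm x * norm v"
    by (rule power2_le_imp_le) simp
qed simp

end

section \<open>Sub-harmonicity of the support projection\<close>

primrec blinfun_power :: "('a::real_normed_vector \<Rightarrow>\<^sub>L 'a) \<Rightarrow> nat \<Rightarrow> ('a \<Rightarrow>\<^sub>L 'a)" where
  "blinfun_power b 0 = id_blinfun"
| "blinfun_power b (Suc n) = blinfun_power b n o\<^sub>L b"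

lemma blinfun_power_apply: "blinfun_power b n v = ((blinfun_apply b) ^^ n) v"
  by (induction n arbitrary: v) (simp_all add: funpow_swap1)

lemma blinfun_power_add_apply: "blinfun_power b (m + n) v = blinfun_power b m (blinfun_power b n v)"
  by (simp add: blinfun_power_apply funpow_add)

lemma is_adjoint_blinfun_power:
  assumes "is_adjoint b b"
  shows "is_adjoint (blinfun_power b n) (blinfun_power b n)"
proof (induction n)
  case (Suc n)
  from is_adjoint_compose[OF assms this] have "is_adjoint (blinfun_power b (Suc n)) (b o\<^sub>L blinfun_power b n)"
    by simp
  moreover have "b o\<^sub>L blinfun_power b n = blinfun_power b (Suc n)"
    by (rule blinfun_eqI) (simp add: blinfun_power_apply funpow_swap1)
  ultimately show ?case
    by simp
qed (simp add: is_adjoint_id)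

lemma norm_blinfun_power_apply_le:
  assumes "norm b \<le> 1"
  shows "norm (blinfun_power b n v) \<le> norm v"
proof (induction n arbitrary: v)
  case (Suc n)
  have "norm (blinfun_power b (Suc n) v) \<le> norm (b v)"
    using Suc.IH by simp
  also have "\<dots> \<le> norm b * norm v"
    by (rule norm_blinfun)
  also have "\<dots> \<le> 1 * norm v"
    by (intro mult_right_mono assms norm_ge_zero)
  finally show ?case
    by simp
qed simp

text \<open>The numbers \<open>c\<^sub>k = \<parallel>b\<^sup>k v\<parallel>\<^sup>2\<close> decrease and are nonnegative, so they converge; by self-adjointness
  \<open>\<langle>b\<^bsup>2n\<^esup> v, b\<^bsup>2m\<^esup> v\<rangle> = c\<^bsub>n + m\<^esub>\<close>. Therefore \<open>\<parallel>b\<^bsup>2n\<^esup> v - b\<^bsup>2m\<^esup> v\<parallel>\<^sup>2 = c\<^bsub>2n\<^esub> - 2 c\<^bsub>n + m\<^esub> + c\<^bsub>2m\<^esub>\<close> tends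
  to zero. Even powers are used because \<open>b\<close> may have the eigenvalue \<open>-1\<close>.\<close>

lemma selfadjoint_contraction_even_powers_converge:
  fixes b :: "'h::complex_hilbert_space op"
  assumes adj: "is_adjoint b b" and contraction: "norm b \<le> 1"
  obtains e where "\<And>v. (\<lambda>n. blinfun_power b (2 * n) v) \<longlonglongrightarrow> blinfun_apply e v"
proof -
  define c where "c v k = (norm (blinfun_power b k v))\<^sup>2" for v k
  have "convergent (\<lambda>n. blinfun_power b (2 * n) v)" for v
  proof -
    have "decseq (c v)"
    proof (rule decseq_SucI)
      fix k
      have "blinfun_power b (Suc k) v = blinfun_power b 1 (blinfun_power b k v)"
        by (simp add: blinfun_power_add_apply[symmetric] del: blinfun_power.simps)
      then show "c v (Suc k) \<le> c v k"
        unfolding c_def by (metis norm_blinfun_power_apply_le[OF contraction] power_mono norm_ge_zero)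
    qed
    then obtain L where L: "c v \<longlonglongrightarrow> L"
      by (rule decseq_convergent[where B = 0]) (auto simp: c_def)
    have ordered: "(norm (blinfun_power b (2 * n) v - blinfun_power b (2 * m) v))\<^sup>2
        = c v (2 * n) - 2 * c v (n + m) + c v (2 * m)" if "m \<le> n" for m n
    proof -
      have exponents: "2 * n = (n - m) + (n + m)" "n + m = (n - m) + 2 * m"
        using that by simp_all
      have "blinfun_power b (2 * n) v = blinfun_power b (n - m) (blinfun_power b (n + m) v)"
        by (subst exponents(1)) (rule blinfun_power_add_apply)
      then have "cinner (blinfun_power b (2 * n) v) (blinfun_power b (2 * m) v)
          = cinner (blinfun_power b (n + m) v) (blinfun_power b (n - m) (blinfun_power b (2 * m) v))"
        using is_adjoint_blinfun_power[OF adj, of "n - m"] by (simp add: is_adjoint_def)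
      also have "blinfun_power b (n - m) (blinfun_power b (2 * m) v) = blinfun_power b (n + m) v"
        by (subst exponents(2)) (rule blinfun_power_add_apply[symmetric])
      finally show ?thesis
        by (simp add: norm_diff_square c_def cinner_self del: of_real_power)
    qed
    have gap: "(norm (blinfun_power b (2 * n) v - blinfun_power b (2 * m) v))\<^sup>2
        = c v (2 * n) - 2 * c v (n + m) + c v (2 * m)" for m n
    proof (cases "m \<le> n")
      case False
      then show ?thesis
        using ordered[of n m] by (simp add: norm_minus_commute add.commute)
    qed (rule ordered)
    have "Cauchy (\<lambda>n. blinfun_power b (2 * n) v)"
    proof (rule CauchyI)
      fix \<epsilon> :: real assume "\<epsilon> > 0"
      then have "\<epsilon>\<^sup>2 / 4 > 0"
        by simp
      from LIMSEQ_D[OF L this] obtain N where N: "\<And>k. k \<ge> N \<Longrightarrow> \<bar>c v k - L\<bar> < \<epsilon>\<^sup>2 / 4"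
        by auto
      have "norm (blinfun_power b (2 * n) v - blinfun_power b (2 * m) v) < \<epsilon>"
        if "N \<le> m" "N \<le> n" for m n
      proof (rule power2_less_imp_less)
        show "(norm (blinfun_power b (2 * n) v - blinfun_power b (2 * m) v))\<^sup>2 < \<epsilon>\<^sup>2"
          using N[of "2 * n"] N[of "n + m"] N[of "2 * m"] that unfolding gap by linarith
      qed (use \<open>\<epsilon> > 0\<close> in simp)
      then show "\<exists>M. \<forall>m\<ge>M. \<forall>n\<ge>M. norm (blinfun_power b (2 * m) v - blinfun_power b (2 * n) v) < \<epsilon>"
        by blast
    qed
    then show ?thesis
      by (rule Cauchy_convergent)
  qed
  then obtain e where e: "\<And>v. (\<lambda>n. blinfun_power b (2 * n) v) \<longlonglongrightarrow> e v"
    unfolding convergent_def by metis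
  have "bounded_linear e"
  proof (rule bounded_linear_intro[where K = 1])
    fix v w :: 'h and r :: real
    have "(\<lambda>n. blinfun_power b (2 * n) (v + w)) \<longlonglongrightarrow> e v + e w"
      using tendsto_add[OF e e] by (simp add: blinfun.add_right)
    then show "e (v + w) = e v + e w"
      using e LIMSEQ_unique by blast
    have "(\<lambda>n. blinfun_power b (2 * n) (r *\<^sub>R v)) \<longlonglongrightarrow> r *\<^sub>R e v"
      using tendsto_scaleR[OF tendsto_const e] by (simp add: blinfun.scaleR_right)
    then show "e (r *\<^sub>R v) = r *\<^sub>R e v"
      using e LIMSEQ_unique by blast
    show "norm (e v) \<le> norm v * 1"
      using tendsto_norm[OF e]
      by (rule LIMSEQ_le_const2) (simp add: norm_blinfun_power_apply_le[OF contraction])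
  qed
  then show ?thesis
    using that[of "Blinfun e"] e by (simp add: bounded_linear_Blinfun_apply)
qed

text \<open>The limit is the orthogonal projection onto the fixed vectors of \<open>b\<^sup>2\<close>.\<close>

lemma even_powers_limit_properties:
  fixes b e :: "'h::complex_hilbert_space op"
  assumes adj: "is_adjoint b b"
    and lim: "\<And>v. (\<lambda>n. blinfun_power b (2 * n) v) \<longlonglongrightarrow> e v"
  shows "b (b (e v)) = e v" and "e o\<^sub>L e = e" and "is_adjoint e e"
proof -
  show fixed: "b (b (e v)) = e v" for v
  proof -
    have "(\<lambda>n. b (b (blinfun_power b (2 * n) v))) \<longlonglongrightarrow> b (b (e v))"
      by (intro blinfun.tendsto tendsto_const lim)
    moreover have "b (b (blinfun_power b (2 * n) v)) = blinfun_power b (2 * Suc n) v" for n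
      using blinfun_power_add_apply[of b 2 "2 * n" v] by (simp add: numeral_2_eq_2)
    ultimately have "(\<lambda>n. blinfun_power b (2 * Suc n) v) \<longlonglongrightarrow> b (b (e v))"
      by simp
    then show ?thesis
      using LIMSEQ_Suc[OF lim[of v]] LIMSEQ_unique by blast
  qed
  have "blinfun_power b (2 * n) (e v) = e v" for n v
    by (induction n) (simp_all add: fixed)
  then have "e (e v) = e v" for v
    using lim[of "e v"] by (simp add: LIMSEQ_const_iff)
  then show "e o\<^sub>L e = e"
    by (intro blinfun_eqI) simp
  show "is_adjoint e e"
    unfolding is_adjoint_def
  proof (intro allI)
    fix v w
    have "(\<lambda>n. cinner (blinfun_power b (2 * n) v) w) \<longlonglongrightarrow> cinner v (e w)"
      using tendsto_cinner_right[OF lim[of w], of v] is_adjoint_blinfun_power[OF adj]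
      by (simp add: is_adjoint_def)
    then show "cinner (e v) w = cinner v (e w)"
      using tendsto_cinner_left[OF lim[of v], of w] LIMSEQ_unique by blast
  qed
qed

text \<open>Put \<open>a = T (1 - p)\<close> and \<open>b = T p = 1 - a\<close>. Invariance gives \<open>\<phi> a = 0\<close>, and \<open>a\<^sup>2 \<le> a\<close> by the
  Schwarz inequality, so \<open>\<phi> (y a) = 0\<close> for all \<open>y\<close> and \<open>\<phi> (b\<^sup>n) = 1\<close> for all \<open>n\<close>. By normality
  the limit projection \<open>e\<close> of the even powers of \<open>b\<close> satisfies \<open>\<phi> e = 1\<close>; it belongs to the
  algebra, so minimality of the support gives \<open>p \<le> e\<close>. Thus \<open>b\<^sup>2\<close> fixes the range of \<open>p\<close>, so
  the contraction \<open>b\<close> does not shorten these vectors, and the Schwarz inequalities for \<open>b\<close> and \<open>a\<close>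
  then force \<open>a\<close> to vanish on them.\<close>

lemma support_projection_subharmonic:
  fixes A :: "'h::complex_hilbert_space op set"
  assumes A: "von_neumann_algebra A"
    and cp: "completely_positive A T" and unital: "T id_blinfun = id_blinfun"
    and \<phi>: "normal_state A id_blinfun \<phi>" and inv: "\<And>x. x \<in> A \<Longrightarrow> \<phi> (T x) = \<phi> x"
    and supp: "support_projection A \<phi> p"
  shows "T (id_blinfun - p) (p v) = 0"
proof -
  have p: "p \<in> A" "projection p" "\<phi> p = 1"
    using supp by (auto simp: support_projection_def)
  define q where "q = id_blinfun - p"
  define a where "a = T q"
  define b where "b = T p"
  have q: "q \<in> A" "projection q"
    using p by (auto simp: q_def von_neumann_diff[OF A] von_neumann_id[OF A] projection_compl)
  have a_eq: "a = id_blinfun - b"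
    by (simp add: a_def b_def q_def cp_diff[OF A cp] unital p von_neumann_id[OF A])
  have mem: "a \<in> A" "b \<in> A"
    using cp_mem[OF cp] p q by (simp_all add: a_def b_def)
  have adj: "is_adjoint a a" "is_adjoint b b"
    using cp_adjoint[OF A cp unital] p q by (simp_all add: a_def b_def projection_def)
  have schwarz: "(norm (a v))\<^sup>2 \<le> Re (cinner v (a v))" "(norm (b v))\<^sup>2 \<le> Re (cinner v (b v))" for v
    using kadison_schwarz[OF A cp unital q(1) q(1)] kadison_schwarz[OF A cp unital p(1) p(1)] p q
    by (simp_all add: a_def b_def projection_def)
  have "\<phi> a = 0"
    using inv[OF q(1)] normal_state_diff[OF \<phi> _ p(1), of id_blinfun] q(1) normal_state_unit[OF \<phi>] p(3)
    by (simp add: a_def q_def)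
  have a_pos: "cinner v (a v) \<in> \<real>\<^sub>\<ge>\<^sub>0" for v
    using cp_positive[OF cp q(1) projection_positive[OF q(2)]]
    by (simp add: a_def positive_op_def)
  have "positive_op (a - (a o\<^sub>L a))"
    using schwarz(1) a_pos cinner_adjoint_compose[OF adj(1)]
    by (simp add: positive_op_def blinfun.diff_left cinner_diff_right complex_nonneg_Reals_iff)
  then have \<phi>aa: "Re (\<phi> (a o\<^sub>L a)) \<le> 0"
    using normal_state_mono[OF A \<phi> von_neumann_compose[OF A mem(1,1)] mem(1)] \<open>\<phi> a = 0\<close> by simp
  have null: "\<phi> (y o\<^sub>L a) = 0" if y: "y \<in> A" for y
  proof -
    obtain ys where ys: "ys \<in> A" "is_adjoint ys y"
      using von_neumann_adjoint[OF A y] .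
    have "\<phi> (y o\<^sub>L ys) \<in> \<real>\<^sub>\<ge>\<^sub>0"
      by (intro normal_state_positive[OF \<phi>] positive_op_adjoint_compose is_adjoint_sym[OF ys(2)] ys
          von_neumann_compose[OF A] y)
    then have "Re (\<phi> (y o\<^sub>L ys)) * Re (\<phi> (a o\<^sub>L a)) \<le> 0"
      by (intro mult_nonneg_nonpos \<phi>aa) (simp add: complex_nonneg_Reals_iff)
    then have "(cmod (\<phi> (y o\<^sub>L a)))\<^sup>2 \<le> 0"
      using normal_state_cauchy_schwarz(2)[OF A \<phi> ys(1) y mem(1) mem(1) is_adjoint_sym[OF ys(2)] adj(1)]
      by (rule order_trans[rotated])
    then show ?thesis
      by simp
  qed
  have pow_mem: "blinfun_power b n \<in> A" for n
    by (induction n) (simp_all add: von_neumann_id[OF A] von_neumann_compose[OF A] mem)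
  have pow_state: "\<phi> (blinfun_power b n) = 1" for n
  proof (induction n)
    case (Suc n)
    let ?c = "blinfun_power b n o\<^sub>L a"
    have c: "?c \<in> A"
      by (rule von_neumann_compose[OF A pow_mem mem(1)])
    have "blinfun_power b (Suc n) = blinfun_power b n - ?c"
      by (rule blinfun_eqI) (simp add: a_eq blinfun.diff_left blinfun.diff_right)
    moreover have "\<phi> (blinfun_power b n - ?c) = \<phi> (blinfun_power b n) - \<phi> ?c"
      by (intro normal_state_diff[OF \<phi>] von_neumann_diff[OF A] pow_mem c)
    ultimately show ?case
      by (simp only: null[OF pow_mem] Suc.IH diff_zero)
  qed (simp add: normal_state_unit[OF \<phi>])
  have b_norm: "norm b \<le> 1"
    using cp_contraction[OF A cp unital p(1)] projection_norm_le[OF p(2)] by (simp add: b_def)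
  obtain e where lim: "\<And>v. (\<lambda>n. blinfun_power b (2 * n) v) \<longlonglongrightarrow> blinfun_apply e v"
    using selfadjoint_contraction_even_powers_converge[OF adj(2) b_norm] by blast
  have "e \<in> A"
    by (rule von_neumann_strong_limit[OF A pow_mem lim])
  have e: "projection e"
    using even_powers_limit_properties[OF adj(2) lim] von_neumann_BH[OF A \<open>e \<in> A\<close>]
    by (simp add: projection_def)
  have "norm (blinfun_power b n) \<le> 1" for n
    by (rule norm_blinfun_bound) (simp_all add: norm_blinfun_power_apply_le[OF b_norm])
  then have "(\<lambda>n. \<phi> (blinfun_power b (2 * n))) \<longlonglongrightarrow> \<phi> e"
    using \<open>e \<in> A\<close> pow_mem lim
    by (intro weak_star_continuous_tendsto[OF normal_state_continuous[OF \<phi>], where K = 1]) auto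
  then have "\<phi> e = 1"
    by (simp add: pow_state LIMSEQ_const_iff)
  then have "positive_op (e - p)"
    using supp e \<open>e \<in> A\<close> by (simp add: support_projection_def)
  then have "e (p v) = p v"
    by (rule projection_le_absorbs[OF p(2) e])
  then have "b (b (p v)) = p v"
    using even_powers_limit_properties(1)[OF adj(2) lim, of "p v"] by simp
  moreover have "norm (b (b (p v))) \<le> norm (b (p v))"
    using norm_blinfun_power_apply_le[OF b_norm, of 1] by simp
  \<comment> \<open>Chain: \<open>\<parallel>p v\<parallel>\<^sup>2 \<le> \<parallel>b p v\<parallel>\<^sup>2 \<le> \<langle>p v, b p v\<rangle>\<close>, so \<open>\<parallel>a p v\<parallel>\<^sup>2 \<le> \<langle>p v, a p v\<rangle> \<le> 0\<close>.\<close>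
  ultimately have "(norm (p v))\<^sup>2 \<le> (norm (b (p v)))\<^sup>2"
    by (simp add: power_mono)
  then have "(norm (p v))\<^sup>2 \<le> Re (cinner (p v) (b (p v)))"
    using schwarz(2) order_trans by blast
  then have "Re (cinner (p v) (a (p v))) \<le> 0"
    by (simp add: a_eq blinfun.diff_left cinner_diff_right cinner_self del: of_real_power)
  then have "(norm (a (p v)))\<^sup>2 \<le> 0"
    using schwarz(1) order_trans by blast
  then show ?thesis
    by (simp add: a_def q_def)
qed

text \<open>Writing \<open>q = 1 - p\<close>, the Schwarz inequality for \<open>y q\<close> and \<open>q y\<^sup>* y q \<le> \<parallel>y\<parallel>\<^sup>2 q\<close> bound
  \<open>\<parallel>T (y q) p v\<parallel>\<^sup>2\<close> by a multiple of \<open>\<langle>p v, T q p v\<rangle> = 0\<close>. Taking adjoints, \<open>p T (q y) = 0\<close>. So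
  of the decomposition \<open>x = p x p + p x q + q x\<close> only the first part contributes.\<close>

lemma subharmonic_compression:
  fixes A :: "'h::complex_hilbert_space op set"
  assumes A: "von_neumann_algebra A"
    and cp: "completely_positive A T" and unital: "T id_blinfun = id_blinfun"
    and p: "p \<in> A" "projection p" and sub: "\<And>v. T (id_blinfun - p) (p v) = 0"
    and x: "x \<in> A"
  shows "p o\<^sub>L T x o\<^sub>L p = p o\<^sub>L T (p o\<^sub>L x o\<^sub>L p) o\<^sub>L p"
proof -
  define q where "q = id_blinfun - p"
  have q: "q \<in> A" "projection q"
    using p by (auto simp: q_def von_neumann_diff[OF A] von_neumann_id[OF A] projection_compl)
  have p_adj: "is_adjoint p p" and q_adj: "is_adjoint q q"
    using p q by (simp_all add: projection_def)
  note closed = von_neumann_compose[OF A] von_neumann_scaleC[OF A] q(1) p(1) x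
  have right: "T (y o\<^sub>L q) (p v) = 0" if y: "y \<in> A" for y v
  proof -
    obtain ys where ys: "ys \<in> A" "is_adjoint ys y"
      using von_neumann_adjoint[OF A y] .
    let ?r = "of_real ((norm y)\<^sup>2) :: complex"
    have "(norm (T (y o\<^sub>L q) (p v)))\<^sup>2
        \<le> Re (cinner (p v) (T ((q o\<^sub>L ys) o\<^sub>L (y o\<^sub>L q)) (p v)))"
      by (intro kadison_schwarz[OF A cp unital] is_adjoint_compose closed ys y q_adj)
    also have "\<dots> \<le> Re (cinner (p v) (T (scaleC_op ?r q) (p v)))"
    proof (intro cp_mono[OF A cp] closed ys y)
      have "scaleC_op ?r q - ((q o\<^sub>L ys) o\<^sub>L (y o\<^sub>L q))
          = q o\<^sub>L (scaleC_op ?r id_blinfun - (ys o\<^sub>L y)) o\<^sub>L q"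
        using von_neumann_BH[OF A q(1)] projection_apply_idem[OF q(2)]
        by (intro blinfun_eqI)
          (simp add: BH_def blinfun.diff_left blinfun.diff_right scaleC_op.rep_eq)
      then show "positive_op (scaleC_op ?r q - ((q o\<^sub>L ys) o\<^sub>L (y o\<^sub>L q)))"
        by (simp only:) (intro positive_op_conjugate positive_op_norm_bound ys q_adj)
    qed
    also have "\<dots> = 0"
      using sub[of v] by (simp add: cp_scaleC[OF cp] q scaleC_op.rep_eq cinner_scaleC_right
          flip: q_def)
    finally show ?thesis
      by simp
  qed
  have left: "p (T (q o\<^sub>L y) w) = 0" if y: "y \<in> A" for y w
  proof -
    obtain ys where ys: "ys \<in> A" "is_adjoint ys y"
      using von_neumann_adjoint[OF A y] .
    have "is_adjoint (T (ys o\<^sub>L q)) (T (q o\<^sub>L y))"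
      by (intro cp_adjoint[OF A cp unital] is_adjoint_compose closed ys y q_adj)
    then have "cinner (T (ys o\<^sub>L q) (p v)) w = cinner v (p (T (q o\<^sub>L y) w))" for v
      using p_adj by (simp add: is_adjoint_def)
    then have "cinner v (p (T (q o\<^sub>L y) w)) = 0" for v
      using right[OF ys(1)] by simp
    from this[of "p (T (q o\<^sub>L y) w)"] show ?thesis
      by (simp add: cinner_self)
  qed
  have "x = (p o\<^sub>L x o\<^sub>L p) + (p o\<^sub>L x o\<^sub>L q) + (q o\<^sub>L x)"
    by (rule blinfun_eqI)
      (simp add: q_def blinfun.add_left blinfun.diff_left blinfun.diff_right)
  then have "T x = T (p o\<^sub>L x o\<^sub>L p) + T (p o\<^sub>L x o\<^sub>L q) + T (q o\<^sub>L x)"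
    by (metis closed cp_add[OF cp] von_neumann_add[OF A])
  then show ?thesis
    using right[of "p o\<^sub>L x"] left[OF x]
    by (intro blinfun_eqI) (simp add: closed blinfun.add_left blinfun.add_right)
qed

section \<open>States on the algebra and on its corner\<close>

lemma compression_compose:
  assumes "projection p"
  shows "p o\<^sub>L (p o\<^sub>L x o\<^sub>L p) o\<^sub>L p = p o\<^sub>L x o\<^sub>L p"
  by (rule blinfun_eqI) (simp add: projection_apply_idem[OF assms])

lemma norm_compression_le:
  assumes "projection p"
  shows "norm (p o\<^sub>L x o\<^sub>L p) \<le> norm x"
proof -
  have "norm (p o\<^sub>L x o\<^sub>L p) \<le> norm (p o\<^sub>L x) * norm p"
    by (rule norm_blinfun_compose)
  also have "\<dots> \<le> (norm p * norm x) * norm p"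
    by (intro mult_right_mono norm_blinfun_compose norm_ge_zero)
  also have "\<dots> \<le> (1 * norm x) * 1"
    by (intro mult_mono mult_right_mono projection_norm_le assms) simp_all
  finally show ?thesis
    by simp
qed

lemma compression_in_corner: "x \<in> A \<Longrightarrow> p o\<^sub>L x o\<^sub>L p \<in> corner p A"
  by (simp add: corner_def)

text \<open>Compression by \<open>p\<close> is the transpose of applying \<open>p\<close> to both sequences of vectors.\<close>

lemma predual_functional_compression:
  assumes "is_adjoint p p"
  shows "predual_functional \<xi> \<eta> (p o\<^sub>L x o\<^sub>L p)
    = predual_functional (\<lambda>n. blinfun_apply p (\<xi> n)) (\<lambda>n. blinfun_apply p (\<eta> n)) x"
  using assms by (simp add: predual_functional_def is_adjoint_def)

lemma normal_state_compose:
  assumes "von_neumann_algebra A" "completely_positive A T" "T id_blinfun = id_blinfun"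
    and "continuous_map (weak_star_topology A) (weak_star_topology A) T"
    and \<phi>: "normal_state A id_blinfun \<phi>"
  shows "normal_state A id_blinfun (\<lambda>x. \<phi> (T x))"
  unfolding normal_state_def linear_functional_on_def
proof (intro conjI ballI allI impI)
  show "continuous_map (weak_star_topology A) euclidean (\<lambda>x. \<phi> (T x))"
    using continuous_map_compose[OF assms(4) normal_state_continuous[OF \<phi>]] by (simp add: o_def)
qed (simp_all add: assms(3) cp_mem[OF assms(2)] cp_add[OF assms(2)] cp_scaleC[OF assms(2)]
    cp_positive[OF assms(2)] normal_state_add[OF \<phi>] normal_state_scaleC[OF \<phi>]
    normal_state_positive[OF \<phi>] normal_state_unit[OF \<phi>])

context
  fixes A :: "'h::complex_hilbert_space op set" and p :: "'h op"
  assumes A: "von_neumann_algebra A" and p: "p \<in> A" "projection p"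
begin

text \<open>Compression is idempotent, so the corner consists of its fixed points in the algebra.\<close>

lemma corner_iff: "x \<in> corner p A \<longleftrightarrow> x \<in> A \<and> p o\<^sub>L x o\<^sub>L p = x"
  unfolding corner_def
proof
  show "x \<in> (\<lambda>x. p o\<^sub>L x o\<^sub>L p) ` A" if "x \<in> A \<and> p o\<^sub>L x o\<^sub>L p = x"
    using that by (intro image_eqI[of x _ x]) simp_all
qed (auto simp: von_neumann_compose[OF A] p compression_compose[OF p(2)])

lemma zero_in_corner: "0 \<in> corner p A"
proof -
  have "(0 :: 'h op) \<in> A"
    using von_neumann_diff[OF A p(1) p(1)] by simp
  then show ?thesis
    by (auto simp: corner_iff intro: blinfun_eqI)
qed

text \<open>Compression is a positive unital map onto the corner (whose unit is \<open>p\<close>) and is weak* continuous,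
  so composing with it preserves normal states.\<close>

lemma normal_state_extend:
  assumes \<phi>: "normal_state (corner p A) p \<phi>"
  shows "normal_state A id_blinfun (\<lambda>x. \<phi> (p o\<^sub>L x o\<^sub>L p))"
  unfolding normal_state_def linear_functional_on_def
proof (intro conjI ballI allI impI)
  fix x y c assume x: "x \<in> A" and y: "y \<in> A"
  have "p o\<^sub>L (x + y) o\<^sub>L p = (p o\<^sub>L x o\<^sub>L p) + (p o\<^sub>L y o\<^sub>L p)"
    by (rule blinfun_eqI) (simp add: blinfun.add_left blinfun.add_right)
  then show "\<phi> (p o\<^sub>L (x + y) o\<^sub>L p) = \<phi> (p o\<^sub>L x o\<^sub>L p) + \<phi> (p o\<^sub>L y o\<^sub>L p)"
    by (simp add: normal_state_add[OF \<phi>] compression_in_corner x y)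
next
  fix x c assume x: "x \<in> A"
  have "p o\<^sub>L scaleC_op c x o\<^sub>L p = scaleC_op c (p o\<^sub>L x o\<^sub>L p)"
    using von_neumann_BH[OF A p(1)] by (intro blinfun_eqI) (simp add: scaleC_op.rep_eq BH_def)
  then show "\<phi> (p o\<^sub>L scaleC_op c x o\<^sub>L p) = c * \<phi> (p o\<^sub>L x o\<^sub>L p)"
    by (simp add: normal_state_scaleC[OF \<phi>] compression_in_corner x)
next
  fix x assume "x \<in> A" "positive_op x"
  then show "\<phi> (p o\<^sub>L x o\<^sub>L p) \<in> \<real>\<^sub>\<ge>\<^sub>0"
    using p(2) by (intro normal_state_positive[OF \<phi>] compression_in_corner positive_op_conjugate)
      (simp_all add: projection_def)
next
  have "p o\<^sub>L id_blinfun o\<^sub>L p = p"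
    by (rule blinfun_eqI) (simp add: projection_apply_idem[OF p(2)])
  then show "\<phi> (p o\<^sub>L id_blinfun o\<^sub>L p) = 1"
    by (simp add: normal_state_unit[OF \<phi>])
next
  have "is_adjoint p p"
    using p(2) by (simp add: projection_def)
  then have "continuous_map (weak_star_topology A) (weak_star_topology (corner p A))
      (\<lambda>x. p o\<^sub>L x o\<^sub>L p)"
    by (intro continuous_map_weak_starI compression_in_corner)
      (auto simp: predual_functional_compression intro!: square_summable_apply)
  from continuous_map_compose[OF this normal_state_continuous[OF \<phi>]]
  show "continuous_map (weak_star_topology A) euclidean (\<lambda>x. \<phi> (p o\<^sub>L x o\<^sub>L p))"
    by (simp add: o_def)
qed

lemma normal_state_restrict:
  assumes \<psi>: "normal_state A id_blinfun \<psi>" and nonzero: "\<psi> p \<noteq> 0"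
  shows "normal_state (corner p A) p (\<lambda>x. \<psi> x / \<psi> p)"
  unfolding normal_state_def linear_functional_on_def
proof (intro conjI ballI allI impI)
  fix x assume "x \<in> corner p A" "positive_op x"
  then have "\<psi> x \<in> \<real>\<^sub>\<ge>\<^sub>0" "\<psi> p \<in> \<real>\<^sub>\<ge>\<^sub>0"
    using normal_state_positive[OF \<psi>] p projection_positive by (auto simp: corner_iff)
  then show "\<psi> x / \<psi> p \<in> \<real>\<^sub>\<ge>\<^sub>0"
    by (rule nonneg_Reals_divide_I)
next
  have "continuous_map (weak_star_topology (corner p A)) (weak_star_topology A) (\<lambda>x. x)"
    by (rule continuous_map_weak_starI) (auto simp: corner_iff)
  from continuous_map_compose[OF this normal_state_continuous[OF \<psi>]]
  have "continuous_map (weak_star_topology (corner p A)) euclidean \<psi>"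
    by (simp add: o_def)
  moreover have "continuous_map euclidean euclidean (\<lambda>z. z / \<psi> p)"
    using nonzero by (auto intro!: continuous_intros)
  ultimately show "continuous_map (weak_star_topology (corner p A)) euclidean (\<lambda>x. \<psi> x / \<psi> p)"
    using continuous_map_compose[of _ _ \<psi> _ "\<lambda>z. z / \<psi> p"] by (simp add: o_def)
qed (simp_all add: corner_iff normal_state_add[OF \<psi>] normal_state_scaleC[OF \<psi>] add_divide_distrib nonzero)

end

section \<open>Convergence to equilibrium\<close>

lemma functional_norm_le:
  assumes "0 \<in> M" and "\<And>x. x \<in> M \<Longrightarrow> norm x \<le> 1 \<Longrightarrow> cmod (f x) \<le> c"
  shows "functional_norm M f \<le> c"
  unfolding functional_norm_def using assms by (intro cSUP_least) auto

text \<open>The supremum is taken in the reals, so it dominates the values only if these are bounded;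
  hence the auxiliary bound \<open>K\<close>.\<close>

lemma functional_norm_upper:
  assumes "\<And>x. x \<in> M \<Longrightarrow> norm x \<le> 1 \<Longrightarrow> cmod (f x) \<le> K" and "x \<in> M" "norm x \<le> 1"
  shows "cmod (f x) \<le> functional_norm M f"
  unfolding functional_norm_def
  by (rule cSUP_upper) (use assms in \<open>auto intro!: bdd_aboveI[of _ K]\<close>)

lemma functional_norm_nonneg:
  assumes "\<And>x. x \<in> M \<Longrightarrow> norm x \<le> 1 \<Longrightarrow> cmod (f x) \<le> K" and "0 \<in> M"
  shows "0 \<le> functional_norm M f"
proof -
  have "cmod (f 0) \<le> functional_norm M f"
    by (rule functional_norm_upper[OF assms]) simp_all
  then show ?thesis
    by (rule order_trans[OF norm_ge_zero])
qed

lemma eventually_at_infinity_in: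
  "eventually P (at_infinity_in I) \<longleftrightarrow> (\<exists>N. \<forall>t\<ge>N. t \<in> I \<longrightarrow> P t)"
  by (simp add: at_infinity_in_def eventually_inf_principal eventually_at_top_linorder)

lemma eventually_in_time_set: "\<forall>\<^sub>F t in at_infinity_in I. t \<in> I"
  by (simp add: eventually_at_infinity_in)

lemma time_set_diff: "time_set I \<Longrightarrow> s \<in> I \<Longrightarrow> t \<in> I \<Longrightarrow> s \<le> t \<Longrightarrow> t - s \<in> I"
  by (auto simp: time_set_def intro: Nats_diff)

lemma at_infinity_in_neq_bot:
  assumes "time_set I"
  shows "at_infinity_in I \<noteq> bot"
proof -
  have "\<exists>t\<ge>N. t \<in> I" for N
    using assms real_arch_simple[of N] unfolding time_set_def by (fastforce intro: of_nat_in_Nats)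
  then show ?thesis
    unfolding trivial_limit_def eventually_at_infinity_in by blast
qed

text \<open>Both admissible time sets contain \<open>t - s\<close> along with \<open>s \<le> t\<close>, so every late time is
  \<open>s\<close> plus a late time.\<close>

lemma eventually_shift_at_infinity_in:
  assumes "time_set I" "s \<in> I" and "\<forall>\<^sub>F t in at_infinity_in I. P (s + t)"
  shows "\<forall>\<^sub>F t in at_infinity_in I. P t"
proof -
  obtain N where N: "\<And>t. t \<ge> N \<Longrightarrow> t \<in> I \<Longrightarrow> P (s + t)"
    using assms(3) unfolding eventually_at_infinity_in by blast
  have "P t" if "t \<ge> max (N + s) s" "t \<in> I" for t
    using N[of "t - s"] time_set_diff[OF assms(1,2) that(2)] that(1) by simp
  then show ?thesis
    unfolding eventually_at_infinity_in by blast
qed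

lemma state_deviation_bound:
  fixes A :: "'h::complex_hilbert_space op set"
  assumes A: "von_neumann_algebra A"
    and cp: "completely_positive A T" and unital: "T id_blinfun = id_blinfun"
    and \<phi>\<^sub>0: "normal_state A id_blinfun \<phi>\<^sub>0" and \<psi>: "normal_state A id_blinfun \<psi>"
    and x: "x \<in> A" "norm x \<le> 1"
  shows "cmod (\<psi> (T x) - \<phi>\<^sub>0 x) \<le> 2"
proof -
  have "cmod (\<psi> (T x) - \<phi>\<^sub>0 x) \<le> cmod (\<psi> (T x)) + cmod (\<phi>\<^sub>0 x)"
    by (rule norm_triangle_ineq4)
  also have "\<dots> \<le> norm (T x) + norm x"
    by (intro add_mono normal_state_norm_le[OF A] x \<psi> \<phi>\<^sub>0 cp_mem[OF cp])
  also have "\<dots> \<le> norm x + norm x"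
    by (intro add_mono cp_contraction[OF A cp unital] x order_refl)
  finally show ?thesis
    using x by linarith
qed

context
  fixes A :: "'h::complex_hilbert_space op set" and T :: "'h op \<Rightarrow> 'h op" and p :: "'h op"
    and \<phi>\<^sub>0 :: "'h op \<Rightarrow> complex"
  assumes A: "von_neumann_algebra A"
    and cp: "completely_positive A T" and unital: "T id_blinfun = id_blinfun"
    and \<phi>\<^sub>0: "normal_state A id_blinfun \<phi>\<^sub>0"
    and p: "p \<in> A" "projection p"
begin

lemma corner_deviation_bound:
  assumes "normal_state (corner p A) p \<phi>" and "x \<in> corner p A" "norm x \<le> 1"
  shows "cmod (\<phi> (p o\<^sub>L T x o\<^sub>L p) - \<phi>\<^sub>0 x) \<le> 2"
  using state_deviation_bound[OF A cp unital \<phi>\<^sub>0 normal_state_extend[OF A p assms(1)]] assms(2,3)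
  by (simp add: corner_iff[OF A p])

lemma corner_functional_norm_le:
  assumes \<phi>: "normal_state (corner p A) p \<phi>"
  shows "functional_norm (corner p A) (\<lambda>x. \<phi> (p o\<^sub>L T x o\<^sub>L p) - \<phi>\<^sub>0 x)
    \<le> functional_norm A (\<lambda>x. \<phi> (p o\<^sub>L T x o\<^sub>L p) - \<phi>\<^sub>0 x)"
proof (rule functional_norm_le[OF zero_in_corner[OF A p]])
  fix x assume "x \<in> corner p A" "norm x \<le> 1"
  then show "cmod (\<phi> (p o\<^sub>L T x o\<^sub>L p) - \<phi>\<^sub>0 x)
      \<le> functional_norm A (\<lambda>x. \<phi> (p o\<^sub>L T x o\<^sub>L p) - \<phi>\<^sub>0 x)"
    using state_deviation_bound[OF A cp unital \<phi>\<^sub>0 normal_state_extend[OF A p \<phi>]]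
    by (intro functional_norm_upper[where K = 2]) (simp_all add: corner_iff[OF A p])
qed

text \<open>Let \<open>y = p x p\<close>, so that \<open>\<phi>\<^sub>0(x) = \<phi>\<^sub>0(y)\<close> and \<open>p T(x) p = p T(y) p\<close>. The deviation is the sum of
  the off-corner part \<open>\<psi>(T x) - \<psi>(p T(y) p)\<close>, the mass defect \<open>(\<psi>(p) - 1) \<phi>\<^sub>0(y)\<close>, and \<open>\<psi>(p)\<close> times
  the deviation of the normalized restriction of \<open>\<psi>\<close> within the corner; these are bounded by the
  three terms on the right.\<close>

lemma state_deviation_le_corner:
  assumes sub: "\<And>v. T (id_blinfun - p) (p v) = 0" and \<phi>\<^sub>0p: "\<phi>\<^sub>0 p = 1"
    and \<psi>: "normal_state A id_blinfun \<psi>" and pos: "Re (\<psi> p) > 0"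
    and x: "x \<in> A" "norm x \<le> 1"
  shows "cmod (\<psi> (T x) - \<phi>\<^sub>0 x) \<le> 2 * sqrt (1 - Re (\<psi> p)) + (1 - Re (\<psi> p))
    + functional_norm (corner p A) (\<lambda>x. \<psi> (p o\<^sub>L T x o\<^sub>L p) / \<psi> p - \<phi>\<^sub>0 x)"
    (is "_ \<le> _ + ?N")
proof -
  define r where "r = Re (\<psi> p)"
  define y where "y = p o\<^sub>L x o\<^sub>L p"
  have "\<psi> p \<in> \<real>\<^sub>\<ge>\<^sub>0"
    by (intro normal_state_positive[OF \<psi>] projection_positive p)
  then have \<psi>p: "\<psi> p = of_real r"
    by (simp add: r_def complex_eq_iff complex_nonneg_Reals_iff)
  have "r \<le> norm p"
    using normal_state_norm_le[OF A \<psi> p(1)] complex_Re_le_cmod[of "\<psi> p"] by (simp add: r_def)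
  then have r: "0 < r" "r \<le> 1"
    using pos projection_norm_le[OF p(2)] by (simp_all add: r_def)
  have y: "y \<in> corner p A" "y \<in> A" "norm y \<le> 1"
    using compression_in_corner[OF x(1)] corner_iff[OF A p] norm_compression_le[OF p(2), of x] x(2)
    by (auto simp: y_def)
  have restrict: "normal_state (corner p A) p (\<lambda>x. \<psi> x / \<psi> p)"
    using normal_state_restrict[OF A p \<psi>] r \<psi>p by simp
  have reduce: "p o\<^sub>L T x o\<^sub>L p = p o\<^sub>L T y o\<^sub>L p"
    unfolding y_def by (rule subharmonic_compression[OF A cp unital p sub x(1)])
  have "cmod (\<phi>\<^sub>0 x - \<phi>\<^sub>0 y) \<le> 0"
    using normal_state_compression[OF A \<phi>\<^sub>0 p x(1)] by (simp add: \<phi>\<^sub>0p y_def)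
  then have \<phi>\<^sub>0y: "\<phi>\<^sub>0 x = \<phi>\<^sub>0 y"
    by simp
  have "cmod (\<psi> (T x) - \<psi> (p o\<^sub>L T x o\<^sub>L p)) \<le> 2 * sqrt (1 - r) * norm (T x)"
    using normal_state_compression[OF A \<psi> p cp_mem[OF cp x(1)]] by (simp add: r_def)
  also have "\<dots> \<le> 2 * sqrt (1 - r) * 1"
    using cp_contraction[OF A cp unital x(1)] x(2) r by (intro mult_left_mono) auto
  finally have off: "cmod (\<psi> (T x) - \<psi> (p o\<^sub>L T y o\<^sub>L p)) \<le> 2 * sqrt (1 - r)"
    by (simp add: reduce)
  have "cmod (\<psi> (p o\<^sub>L T y o\<^sub>L p) / \<psi> p - \<phi>\<^sub>0 y) \<le> ?N"
    using corner_deviation_bound[OF restrict] by (intro functional_norm_upper[where K = 2] y)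
  then have corner: "cmod (of_real r * (\<psi> (p o\<^sub>L T y o\<^sub>L p) / \<psi> p - \<phi>\<^sub>0 y)) \<le> ?N"
    using r by (auto simp: norm_mult intro: order_trans[OF mult_left_le_one_le])
  have "cmod (\<phi>\<^sub>0 y) \<le> 1"
    using normal_state_norm_le[OF A \<phi>\<^sub>0 y(2)] y(3) by linarith
  then have rest: "cmod (of_real (r - 1) * \<phi>\<^sub>0 y) \<le> 1 - r"
    using r by (simp add: norm_mult mult_left_le del: of_real_diff)
  have "\<psi> (T x) - \<phi>\<^sub>0 x = (\<psi> (T x) - \<psi> (p o\<^sub>L T y o\<^sub>L p)) + of_real (r - 1) * \<phi>\<^sub>0 y
      + of_real r * (\<psi> (p o\<^sub>L T y o\<^sub>L p) / \<psi> p - \<phi>\<^sub>0 y)"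
    using r by (simp add: \<phi>\<^sub>0y \<psi>p algebra_simps)
  then show ?thesis
    unfolding r_def[symmetric]
    by (simp only:) (intro norm_triangle_mono off rest corner)
qed

end

theorem theorem3p1:
  fixes A\<^sub>0 :: "'h::complex_hilbert_space op set"
    and I :: "real set"
    and \<tau> :: "real \<Rightarrow> 'h op \<Rightarrow> 'h op"
    and \<phi>\<^sub>0 :: "'h op \<Rightarrow> complex"
    and p :: "'h op"
  assumes "separable_space (euclidean :: 'h topology)"
    and "von_neumann_algebra A\<^sub>0"
    and "quantum_dynamical_semigroup A\<^sub>0 I \<tau>"
    and "normal_state A\<^sub>0 id_blinfun \<phi>\<^sub>0"
    and "invariant_state A\<^sub>0 I \<tau> \<phi>\<^sub>0"
    and "support_projection A\<^sub>0 \<phi>\<^sub>0 p"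
    and "limitin strong_operator_topology (\<lambda>t. \<tau> t p) id_blinfun (at_infinity_in I)"
  shows "(\<forall>\<phi>. normal_state A\<^sub>0 id_blinfun \<phi> \<longrightarrow>
            ((\<lambda>t. functional_norm A\<^sub>0 (\<lambda>x. \<phi> (\<tau> t x) - \<phi>\<^sub>0 x)) \<longlongrightarrow> 0) (at_infinity_in I))
     \<longleftrightarrow> (\<forall>\<phi>. normal_state (corner p A\<^sub>0) p \<phi> \<longrightarrow>
            ((\<lambda>t. functional_norm (corner p A\<^sub>0)
                (\<lambda>x. \<phi> (reduced_semigroup p \<tau> t x) - \<phi>\<^sub>0 x)) \<longlongrightarrow> 0) (at_infinity_in I))"
  (is "?full \<longleftrightarrow> ?reduced")
proof -
  let ?F = "at_infinity_in I"
  note A = assms(2)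
  note \<phi>\<^sub>0 = assms(4)
  have p: "p \<in> A\<^sub>0" "projection p" and \<phi>\<^sub>0p: "\<phi>\<^sub>0 p = 1"
    using assms(6) by (simp_all add: support_projection_def)
  have I: "time_set I"
    and semigroup: "\<And>s t x. s \<in> I \<Longrightarrow> t \<in> I \<Longrightarrow> x \<in> A\<^sub>0 \<Longrightarrow> \<tau> (s + t) x = \<tau> s (\<tau> t x)"
    and cp: "\<And>t. t \<in> I \<Longrightarrow> completely_positive A\<^sub>0 (\<tau> t)"
    and unital: "\<And>t. t \<in> I \<Longrightarrow> \<tau> t id_blinfun = id_blinfun"
    and normal: "\<And>t. t \<in> I \<Longrightarrow>
      continuous_map (weak_star_topology A\<^sub>0) (weak_star_topology A\<^sub>0) (\<tau> t)"
    using assms(3) by (simp_all add: quantum_dynamical_semigroup_def)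
  have zero: "(0 :: 'h op) \<in> A\<^sub>0"
    using von_neumann_diff[OF A p(1) p(1)] by simp
  have sub: "\<tau> t (id_blinfun - p) (p v) = 0" if "t \<in> I" for t v
    using support_projection_subharmonic[OF A cp[OF that] unital[OF that] \<phi>\<^sub>0 _ assms(6)] assms(5) that
    by (simp add: invariant_state_def)
  show ?thesis
  proof
    assume full: ?full
    show ?reduced
    proof (intro allI impI)
      fix \<phi> assume \<phi>: "normal_state (corner p A\<^sub>0) p \<phi>"
      let ?N = "\<lambda>M t. functional_norm M (\<lambda>x. \<phi> (p o\<^sub>L \<tau> t x o\<^sub>L p) - \<phi>\<^sub>0 x)"
      have lim: "(?N A\<^sub>0 \<longlongrightarrow> 0) ?F"
        using full normal_state_extend[OF A p \<phi>] by blast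
      have "0 \<le> ?N (corner p A\<^sub>0) t" "?N (corner p A\<^sub>0) t \<le> ?N A\<^sub>0 t" if "t \<in> I" for t
        using corner_deviation_bound[OF A cp[OF that] unital[OF that] \<phi>\<^sub>0 p \<phi>]
          corner_functional_norm_le[OF A cp[OF that] unital[OF that] \<phi>\<^sub>0 p \<phi>]
          zero_in_corner[OF A p]
        by (auto intro: functional_norm_nonneg)
      then have "(?N (corner p A\<^sub>0) \<longlongrightarrow> 0) ?F"
        by (intro tendsto_sandwich[OF _ _ tendsto_const lim])
          (auto intro: eventually_mono[OF eventually_in_time_set])
      then show "((\<lambda>t. functional_norm (corner p A\<^sub>0)
          (\<lambda>x. \<phi> (reduced_semigroup p \<tau> t x) - \<phi>\<^sub>0 x)) \<longlongrightarrow> 0) ?F"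
        by (simp add: reduced_semigroup_def)
    qed
  next
    assume reduced: ?reduced
    show ?full
    proof (intro allI impI tendstoI)
      fix \<phi> and \<epsilon> :: real
      assume \<phi>: "normal_state A\<^sub>0 id_blinfun \<phi>" and \<epsilon>: "\<epsilon> > 0"
      have "((\<lambda>s. \<tau> s p v) \<longlongrightarrow> id_blinfun v) ?F" for v
        using continuous_map_limit[OF strong_operator_topology_continuous_evaluation assms(7)]
        by (simp add: o_def)
      moreover have "norm (\<tau> s p) \<le> 1" if "s \<in> I" for s
        using cp_contraction[OF A cp[OF that] unital[OF that] p(1)] projection_norm_le[OF p(2)]
        by linarith
      ultimately have "((\<lambda>s. \<phi> (\<tau> s p)) \<longlongrightarrow> \<phi> id_blinfun) ?F"
        using cp_mem[OF cp p(1)]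
        by (intro weak_star_continuous_tendsto[OF normal_state_continuous[OF \<phi>], where K = 1]
            at_infinity_in_neq_bot[OF I] von_neumann_id[OF A])
          (auto intro: eventually_mono[OF eventually_in_time_set])
      from tendsto_Re[OF this] have mass: "((\<lambda>s. Re (\<phi> (\<tau> s p))) \<longlongrightarrow> 1) ?F"
        by (simp add: normal_state_unit[OF \<phi>])
      have "((\<lambda>s. 2 * sqrt (1 - Re (\<phi> (\<tau> s p))) + (1 - Re (\<phi> (\<tau> s p))))
          \<longlongrightarrow> 2 * sqrt (1 - 1) + (1 - 1)) ?F"
        by (intro tendsto_intros mass)
      then have "\<forall>\<^sub>F s in ?F. 2 * sqrt (1 - Re (\<phi> (\<tau> s p))) + (1 - Re (\<phi> (\<tau> s p))) < \<epsilon> / 2"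
        using \<epsilon> by (intro order_tendstoD(2)) auto
      moreover have "\<forall>\<^sub>F s in ?F. 0 < Re (\<phi> (\<tau> s p))"
        by (rule order_tendstoD(1)[OF mass]) simp
      ultimately have "\<exists>s. 2 * sqrt (1 - Re (\<phi> (\<tau> s p))) + (1 - Re (\<phi> (\<tau> s p))) < \<epsilon> / 2
          \<and> 0 < Re (\<phi> (\<tau> s p)) \<and> s \<in> I"
        using eventually_in_time_set
        by (intro eventually_happens'[OF at_infinity_in_neq_bot[OF I]] eventually_conj)
      \<comment> \<open>A time \<open>s\<close> after which the state has enough mass in the corner for the error terms of
        \<open>state_deviation_le_corner\<close> to be below \<open>\<epsilon> / 2\<close>, whatever further time elapses.\<close>
      then obtain s where s: "s \<in> I" and pos: "0 < Re (\<phi> (\<tau> s p))"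
        and small: "2 * sqrt (1 - Re (\<phi> (\<tau> s p))) + (1 - Re (\<phi> (\<tau> s p))) < \<epsilon> / 2"
        by blast
      define \<psi> where "\<psi> x = \<phi> (\<tau> s x)" for x
      have \<psi>: "normal_state A\<^sub>0 id_blinfun \<psi>"
        unfolding \<psi>_def by (rule normal_state_compose[OF A cp[OF s] unital[OF s] normal[OF s] \<phi>])
      let ?N = "\<lambda>t. functional_norm (corner p A\<^sub>0) (\<lambda>x. \<psi> (p o\<^sub>L \<tau> t x o\<^sub>L p) / \<psi> p - \<phi>\<^sub>0 x)"
      have "normal_state (corner p A\<^sub>0) p (\<lambda>x. \<psi> x / \<psi> p)"
        using pos by (intro normal_state_restrict[OF A p \<psi>]) (auto simp: \<psi>_def)
      then have "(?N \<longlongrightarrow> 0) ?F"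
        using reduced by (auto simp: reduced_semigroup_def)
      then have "\<forall>\<^sub>F t in ?F. ?N t < \<epsilon> / 2"
        using \<epsilon> by (intro order_tendstoD(2)) auto
      then have "\<forall>\<^sub>F t in ?F. dist (functional_norm A\<^sub>0 (\<lambda>x. \<phi> (\<tau> (s + t) x) - \<phi>\<^sub>0 x)) 0 < \<epsilon>"
        using eventually_in_time_set
      proof eventually_elim
        case (elim t)
        have cong: "\<phi> (\<tau> (s + t) x) = \<psi> (\<tau> t x)" if "x \<in> A\<^sub>0" for x
          using semigroup[OF s elim(2) that] by (simp add: \<psi>_def)
        let ?f = "\<lambda>x. \<phi> (\<tau> (s + t) x) - \<phi>\<^sub>0 x"
        have bound: "cmod (?f x) \<le> 2 * sqrt (1 - Re (\<psi> p)) + (1 - Re (\<psi> p)) + ?N t"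
          if "x \<in> A\<^sub>0" "norm x \<le> 1" for x
          using state_deviation_le_corner[OF A cp[OF elim(2)] unital[OF elim(2)] \<phi>\<^sub>0 p sub[OF elim(2)]
              \<phi>\<^sub>0p \<psi> _ that] pos
          by (simp add: cong that \<psi>_def)
        have "0 \<le> functional_norm A\<^sub>0 ?f"
          by (rule functional_norm_nonneg[OF bound zero])
        moreover have "functional_norm A\<^sub>0 ?f \<le> 2 * sqrt (1 - Re (\<psi> p)) + (1 - Re (\<psi> p)) + ?N t"
          by (rule functional_norm_le[OF zero bound])
        ultimately show ?case
          using small elim(1) by (simp add: \<psi>_def)
      qed
      then show "\<forall>\<^sub>F t in ?F. dist (functional_norm A\<^sub>0 (\<lambda>x. \<phi> (\<tau> t x) - \<phi>\<^sub>0 x)) 0 < \<epsilon>"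
        by (rule eventually_shift_at_infinity_in[OF I s])
    qed
  qed
qed

end
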